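(* Let $\sigma>0$ and $\rho=\frac{\sigma}{2}$. There is a constant $\tilde c>0$, independent of $N$, such that for every integer $N>1$ the following holds. Let $t_1>t_2>\cdots>t_N$ be the zeros of the Hermite polynomial $H_N$, let $$\lambda_j=-\mathrm i\sqrt{\frac{2(\rho+\sigma)}{\sigma(2\rho+\sigma)}}\;t_j,\qquad j=1,\ldots,N,$$ and let $\gamma_1,\ldots,\gamma_N$ be the solution of the linear system $$\sum_{j=1}^N\mathrm e^{(\lambda_j-\lambda_k)^2\rho/2}\,\gamma_j=\sqrt{\frac{\sigma}{\sigma+\rho}}\;\mathrm e^{\frac{\sigma\rho\lambda_k^2}{2(\sigma+\rho)}},\qquad k=1,\ldots,N.$$ Further let $T:=\sqrt{2\sigma N\ln 2}$. Then $$\Big\|\mathrm e^{-\cdot^2/2\sigma}-\chi_{[-T,T]}(\cdot)\sum_{k=1}^N\gamma_k\,\mathrm e^{\lambda_k\cdot}\Big\|^2_{L^2(\mathbb R)}\le\tilde c\,2^{-2N}N^{3/2}.$$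
   Context: $\chi_{[-T,T]}$ is the characteristic function of the interval $[-T,T]$, and $\|\cdot\|_{L^2(\mathbb R)}$ is the usual unweighted $L^2$ norm. The physicist's Hermite polynomials are $H_n(t)=(-1)^n\mathrm e^{t^2}\frac{\mathrm d^n}{\mathrm dt^n}\mathrm e^{-t^2}$; $H_N$ has $N$ simple real zeros. The matrix of the linear system is real, symmetric and positive definite, so its solution is unique. *)

theory Defs
  imports "HOL-Probability.Distributions"
begin

definition hermite :: "nat \<Rightarrow> real \<Rightarrow> real" where
  "hermite n t = (-1) ^ n * exp (t\<^sup>2) * (deriv ^^ n) (\<lambda>s. exp (- s\<^sup>2)) t"

text \<open>The Bochner integral is \<open>0\<close> when \<open>\<bar>f\<bar>\<^sup>2\<close> is not integrable, so \<open>l2_norm f\<close> is the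
  \<open>L\<^sup>2\<close> norm only for square-integrable \<open>f\<close>; the lemma \<open>square_integrable_gauss_diff\<close> below
  shows that the functions whose norm is taken are of this kind.\<close>

definition l2_norm :: "(real \<Rightarrow> complex) \<Rightarrow> real" where
  "l2_norm f = sqrt (LINT x|lborel. (cmod (f x))\<^sup>2)"

lemma square_integrable_gauss_diff:
  fixes \<sigma> T :: real and \<gamma> lam :: "nat \<Rightarrow> complex"
  assumes "\<sigma> > 0"
  shows "integrable lborel (\<lambda>x::real. (cmod (of_real (exp (- x\<^sup>2 / (2 * \<sigma>)))
           - indicator {-T..T} x * (\<Sum>k=1..N. \<gamma> k * exp (lam k * of_real x))))\<^sup>2)"
proof -
  define g where "g x = exp (- x\<^sup>2 / (2 * \<sigma>))" for x :: real
  define s where "s x = (\<Sum>k=1..N. \<gamma> k * exp (lam k * of_real x))" for x :: real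
  define h where "h x = indicator {-T..T} x *\<^sub>R (cmod (s x))\<^sup>2" for x :: real
  have "integrable lborel (normal_density 0 (sqrt (\<sigma> / 2)))"
    using assms by simp
  then have "integrable lborel (\<lambda>x. sqrt (pi * \<sigma>) * normal_density 0 (sqrt (\<sigma> / 2)) x)"
    by simp
  also have "(\<lambda>x. sqrt (pi * \<sigma>) * normal_density 0 (sqrt (\<sigma> / 2)) x) = (\<lambda>x. (g x)\<^sup>2)"
    using assms by (simp add: fun_eq_iff normal_density_def g_def exp_double [symmetric])
  finally have g: "integrable lborel (\<lambda>x. (g x)\<^sup>2)" .
  have h: "integrable lborel h"
    unfolding h_def s_def
    by (rule borel_integrable_compact) (auto intro!: continuous_intros)
  have i: "integrable lborel (\<lambda>x. 2 * (g x)\<^sup>2 + 2 * h x)"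
    using g h by simp
  have le: "(cmod (of_real (g x) - indicator {-T..T} x * s x))\<^sup>2 \<le> 2 * (g x)\<^sup>2 + 2 * h x" for x
  proof -
    let ?u = "of_real (g x) :: complex" and ?v = "indicator {-T..T} x * s x"
    have "(cmod (?u - ?v))\<^sup>2 \<le> (cmod ?u + cmod ?v)\<^sup>2"
      by (intro power_mono norm_triangle_ineq4) simp
    also have "\<dots> \<le> 2 * (cmod ?u)\<^sup>2 + 2 * (cmod ?v)\<^sup>2"
      using sum_squares_bound [of "cmod ?u" "cmod ?v"] by (simp add: power2_sum)
    finally show ?thesis
      by (cases "x \<in> {-T..T}") (simp_all add: h_def g_def)
  qed
  have [measurable]: "s \<in> borel_measurable borel"
    unfolding s_def by (intro borel_measurable_continuous_onI continuous_intros)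
  have [measurable]: "g \<in> borel_measurable borel"
    unfolding g_def by measurable
  show ?thesis
    unfolding g_def [symmetric] s_def [symmetric]
  proof (rule Bochner_Integration.integrable_bound [OF i])
    show "(\<lambda>x. (cmod (of_real (g x) - indicator {-T..T} x * s x))\<^sup>2) \<in> borel_measurable lborel"
      by measurable
    show "AE x in lborel. norm ((cmod (of_real (g x) - indicator {-T..T} x * s x))\<^sup>2)
        \<le> norm (2 * (g x)\<^sup>2 + 2 * h x)"
      by (intro AE_I2) (use le in \<open>fastforce intro: order_trans [OF _ abs_ge_self]\<close>)
  qed
qed

end

(* The coefficients solve the normal equations of a least squares problem with weight exp(-x^2/sigma),
   and this weight is at least 4^-N on [-T, T]. So it suffices to bound the weighted error by
   O(N 16^-N) for one choice of coefficients; the tail of the Gaussian contributes O(4^-N).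

   Represent the Gaussian as an integral of exponentials and discretise it by N-point Gauss-Hermite
   quadrature. The quadrature error A(z) for t |-> exp(2tz) satisfies
     |A(z)| <= 2^N N!/(2N)! |z|^(2N) exp((Re z)^2):
   it is an integral of divided differences of exp(2tz) at the nodes, which up to the factor
   |z / Re z|^(N-1) are dominated by their values at Re z, and the power series coefficients of
   these in turn by the corresponding Hermite moments. The error of the
   discretised Gaussian is a Gaussian average of A over the shifted line z = p - iv; this shift
   makes the weighted square integral of the bound a planar Gaussian moment, with value
   proportional to (2^N N!/(2N)!)^2 (2N)!/16^N = 16^-N 4^N / binomial(2N, N). *)

theory Submission
  imports Defs "HOL-Probability.Probability"
begin

section \<open>Hermite polynomials\<close>

text \<open>In the variable v with x = sqrt(6 \<sigma>) v, the target is e^(-3v^2), the weight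
  e^(-6v^2), and the exponentials are e^(-3i t_j v). The kernel exp(-(2z + 3iv)^2), integrated over
  real z, sends e^(z^2) to a multiple of e^(-3v^2) and e^(2tz) to a multiple of e^(-3itv). As
  e^(z^2) is the Gaussian mean of e^(2tz) over t, quadrature at the zeros of H_N produces exactly
  the admissible frequencies. For real z the kernel has modulus e^(9v^2 - 4z^2), and its square
  overwhelms the weight. On z = p - iv the modulus is e^(v^2 - 4p^2); squared and weighted, this
  decays in v at rate 6 - 2 = 4, the rate that Cauchy-Schwarz leaves in p, so the moment is rotation
  invariant. It matters that the error bound has the factor e^((Re z)^2): the e^(|z|^2) of a
  termwise power series estimate would halve the decay rate in v and lose an exponential factor in
  N. Hence the divided differences are moved to the real axis before their series is
  expanded.\<close>

fun hermite_rec :: "nat \<Rightarrow> real \<Rightarrow> real" where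
  "hermite_rec 0 t = 1"
| "hermite_rec (Suc 0) t = 2 * t"
| "hermite_rec (Suc (Suc n)) t = 2 * t * hermite_rec (Suc n) t - 2 * real (Suc n) * hermite_rec n t"

lemma hermite_rec_Suc:
  "hermite_rec (Suc n) t = 2 * t * hermite_rec n t - 2 * real n * hermite_rec (n - 1) t"
  by (cases n) auto

lemma hermite_rec_deriv:
  "(hermite_rec n has_field_derivative 2 * real n * hermite_rec (n - 1) t) (at t)"
proof (induction n arbitrary: t rule: induct_nat_012)
  case 0
  have "hermite_rec 0 = (\<lambda>t. 1)" by auto
  then show ?case by simp
next
  case 1
  have "hermite_rec (Suc 0) = (\<lambda>t. 2 * t)" by auto
  then show ?case by (auto intro!: derivative_eq_intros)
next
  case (ge2 n)
  have *: "hermite_rec (Suc (Suc n)) =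
      (\<lambda>t. 2 * t * hermite_rec (Suc n) t - 2 * real (Suc n) * hermite_rec n t)"
    by auto
  show ?case unfolding *
    by (rule derivative_eq_intros ge2 refl)+
       (simp add: hermite_rec_Suc[of n] algebra_simps del: hermite_rec.simps)
qed

lemma hermite_eq_rec: "hermite n t = hermite_rec n t"
proof -
  have "(deriv ^^ n) (\<lambda>s. exp (- s\<^sup>2)) = (\<lambda>s. (-1) ^ n * hermite_rec n s * exp (- s\<^sup>2))"
  proof (induction n)
    case 0 then show ?case by simp
  next
    case (Suc n)
    have "((\<lambda>s. (-1) ^ n * hermite_rec n s * exp (- s\<^sup>2)) has_field_derivative
            (-1) ^ Suc n * hermite_rec (Suc n) s * exp (- s\<^sup>2)) (at s)" for s
      by (rule derivative_eq_intros hermite_rec_deriv refl)+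
         (simp add: hermite_rec_Suc algebra_simps)
    then show ?case by (simp add: Suc fun_eq_iff DERIV_imp_deriv del: hermite_rec.simps)
  qed
  then have "hermite n t = ((-1) ^ n * (-1) ^ n) * (exp (t\<^sup>2) * exp (- t\<^sup>2)) * hermite_rec n t"
    by (simp add: hermite_def mult_ac)
  then show ?thesis by (simp add: exp_minus flip: power_mult_distrib)
qed

lemma hermite_0: "hermite 0 t = 1"
  by (simp add: hermite_eq_rec)

lemma hermite_Suc: "hermite (Suc n) t = 2 * t * hermite n t - 2 * real n * hermite (n - 1) t"
  by (simp only: hermite_eq_rec hermite_rec_Suc)

text \<open>Two consecutive zeros would travel down the three-term recurrence to H_0 = 1. Hence
  H_(N-1) does not vanish at the nodes, where the quadrature weights divide by it.\<close>

lemma hermite_consecutive_nonzero: "hermite n t = 0 \<Longrightarrow> hermite (Suc n) t \<noteq> 0"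
proof (induction n)
  case 0 then show ?case by (simp add: hermite_0)
next
  case (Suc n)
  then show ?case by (auto simp: hermite_Suc[of "Suc n"])
qed

section \<open>Divided differences of the exponential\<close>

text \<open>Lagrange form of the divided difference at the nodes \<open>S\<close>; values in a real
  vector space let real and complex exponentials share one definition.\<close>

definition divdiff :: "real set \<Rightarrow> (real \<Rightarrow> 'a::real_vector) \<Rightarrow> 'a" where
  "divdiff S f = (\<Sum>a\<in>S. (1 / (\<Prod>b\<in>S - {a}. a - b)) *\<^sub>R f a)"

lemma divdiff_scaleR: "divdiff S (\<lambda>t. c *\<^sub>R f t) = c *\<^sub>R divdiff S f"
  by (simp add: divdiff_def scaleR_sum_right mult_ac)

lemma divdiff_mult: "divdiff S (\<lambda>t. c * f t) = c * divdiff S f"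
  for c :: "'a::real_algebra"
  by (simp add: divdiff_def sum_distrib_left)

lemma divdiff_add: "divdiff S (\<lambda>t. f t + g t) = divdiff S f + divdiff S g"
  by (simp add: divdiff_def scaleR_add_right sum.distrib)

lemma divdiff_diff: "divdiff S (\<lambda>t. f t - g t) = divdiff S f - divdiff S g"
  by (simp add: divdiff_def scaleR_diff_right sum_subtractf)

lemma divdiff_singleton [simp]: "divdiff {a} f = f a"
  by (simp add: divdiff_def)

text \<open>The factor \<open>t - a\<close> kills the term at \<open>a\<close> and cancels in every
  other denominator, so it removes a node. This drives the inductions below.\<close>

lemma divdiff_mult_node:
  assumes "finite S" "a \<in> S"
  shows "divdiff S (\<lambda>t. (t - a) *\<^sub>R f t) = divdiff (S - {a}) f"
proof -
  have "divdiff S (\<lambda>t. (t - a) *\<^sub>R f t)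
      = (\<Sum>c\<in>S - {a}. (1 / (\<Prod>b\<in>S - {c}. c - b)) *\<^sub>R ((c - a) *\<^sub>R f c))"
    unfolding divdiff_def using assms by (subst sum.remove[of _ a]) auto
  also have "\<dots> = divdiff (S - {a}) f"
    unfolding divdiff_def
  proof (rule sum.cong)
    fix c assume c: "c \<in> S - {a}"
    then have "(\<Prod>b\<in>S - {c}. c - b) = (c - a) * (\<Prod>b\<in>S - {a} - {c}. c - b)"
      using assms by (subst prod.remove[of _ a]) (auto simp: Diff_insert2[symmetric] insert_commute)
    then show "(1 / (\<Prod>b\<in>S - {c}. c - b)) *\<^sub>R ((c - a) *\<^sub>R f c) = (1 / (\<Prod>b\<in>S - {a} - {c}. c - b)) *\<^sub>R f c"
      using c by simp
  qed simp
  finally show ?thesis .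
qed

lemma divdiff_const:
  assumes "card S \<ge> 2"
  shows "divdiff S (\<lambda>_. c) = 0"
  using assms
proof (induction "card S" arbitrary: S rule: less_induct)
  case less
  have fin: "finite S" using less.prems by (metis card.infinite not_numeral_le_zero)
  obtain a b where ab: "a \<in> S" "b \<in> S" "a \<noteq> b"
    using less.prems fin by (metis card_le_Suc0_iff_eq not_less_eq_eq numeral_2_eq_2)
  \<comment> \<open>The scalar \<open>b - a\<close> is \<open>(t - a) - (t - b)\<close>, and each of
    these factors removes one node.\<close>
  have "(b - a) *\<^sub>R divdiff S (\<lambda>_. c) = divdiff S (\<lambda>t. (t - a) *\<^sub>R c - (t - b) *\<^sub>R c)"
    by (simp flip: divdiff_scaleR scaleR_diff_left)
  also have "\<dots> = divdiff (S - {a}) (\<lambda>_. c) - divdiff (S - {b}) (\<lambda>_. c)"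
    using fin ab by (simp add: divdiff_diff divdiff_mult_node)
  also have "\<dots> = 0"
  proof (cases "card S = 2")
    case True
    then have "S = {a, b}" using ab fin
      by (metis card_2_iff doubleton_eq_iff insert_iff singletonD)
    then have "S - {a} = {b}" "S - {b} = {a}" using ab by auto
    then show ?thesis by simp
  next
    case False
    then have "card (S - {a}) < card S" "card (S - {a}) \<ge> 2" "card (S - {b}) < card S" "card (S - {b}) \<ge> 2"
      using less.prems ab fin by auto
    then show ?thesis using less.hyps by simp
  qed
  finally show ?case using ab by simp
qed

lemma divdiff_power:
  assumes "finite S" "j < card S"
  shows "divdiff S (\<lambda>t. t ^ j) = (if Suc j = card S then 1 else 0)"
  using assms
proof (induction j arbitrary: S)
  case 0
  show ?case
  proof (cases "card S = 1")
    case True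
    then obtain a where "S = {a}" by (auto simp: card_Suc_eq)
    then show ?thesis by simp
  next
    case False
    then show ?thesis using 0 divdiff_const[of S 1] by simp
  qed
next
  case (Suc j)
  then obtain a where a: "a \<in> S" by fastforce
  have "divdiff S (\<lambda>t. t ^ Suc j) = divdiff S (\<lambda>t. (t - a) *\<^sub>R t ^ j + a *\<^sub>R t ^ j)"
    by (simp add: algebra_simps)
  also have "\<dots> = divdiff (S - {a}) (\<lambda>t. t ^ j) + a *\<^sub>R divdiff S (\<lambda>t. t ^ j)"
    using Suc.prems a by (simp only: divdiff_add divdiff_mult_node divdiff_scaleR)
  also have "\<dots> = (if Suc (Suc j) = card S then 1 else 0)"
    using Suc a by auto
  finally show ?case .
qed

lemma exp_of_real_has_vector_derivative:
  fixes c :: "'a::{real_normed_field,banach}"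
  shows "((\<lambda>s. exp (c * of_real s)) has_vector_derivative c * exp (c * of_real s)) (at s within A)"
  using exp_scaleR_has_vector_derivative_right[of c s A]
  by (simp add: scaleR_conv_of_real mult.commute)

lemma divdiff_exp_integral:
  fixes z :: "'a::{real_normed_field,banach}"
  assumes S: "finite S" "S \<noteq> {}" "a \<notin> S" and r: "r \<ge> (0::real)"
  shows "((\<lambda>s. 2 * z * exp (2 * of_real a * z * of_real (r - s)) *
              divdiff S (\<lambda>t. exp (2 * of_real t * z * of_real s))) has_integral
          divdiff (insert a S) (\<lambda>t. exp (2 * of_real t * z * of_real r))) {0..r}"
proof -
  let ?E = "\<lambda>s t. exp (2 * of_real t * z * of_real s)"
  let ?D = "\<lambda>s. divdiff (insert a S) (?E s)"
  let ?c = "2 * of_real a * z"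
  have D: "(?D has_vector_derivative
      divdiff (insert a S) (\<lambda>t. 2 * of_real t * z * ?E s t)) (at s within A)" for s A
    unfolding divdiff_def
    by (intro has_vector_derivative_sum bounded_linear.has_vector_derivative[OF bounded_linear_scaleR_right]
        exp_of_real_has_vector_derivative)
  \<comment> \<open>Splitting \<open>t = a + (t - a)\<close> and removing the node \<open>a\<close>
    gives the linear equation D' = 2az D + 2z D_S, solved below with an integrating factor.\<close>
  have rec: "divdiff (insert a S) (\<lambda>t. 2 * of_real t * z * ?E s t) = ?c * ?D s + 2 * z * divdiff S (?E s)" for s
  proof -
    have "2 * z * divdiff S (?E s) = divdiff (insert a S) (\<lambda>t. 2 * z * ((t - a) *\<^sub>R ?E s t))"
      using S by (simp add: divdiff_mult divdiff_mult_node)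
    moreover have "(\<lambda>t. 2 * of_real t * z * ?E s t) = (\<lambda>t. ?c * ?E s t + 2 * z * ((t - a) *\<^sub>R ?E s t))"
      by (simp add: fun_eq_iff scaleR_conv_of_real algebra_simps)
    ultimately show ?thesis
      by (simp only: divdiff_add divdiff_mult)
  qed
  have "((\<lambda>s. exp (?c * of_real (r - s)) * ?D s) has_vector_derivative
      2 * z * exp (?c * of_real (r - s)) * divdiff S (?E s)) (at s within {0..r})" for s
  proof -
    let ?D' = "divdiff (insert a S) (\<lambda>t. 2 * of_real t * z * ?E s t)"
    have "((\<lambda>s. exp (?c * of_real r) * (exp (- ?c * of_real s) * ?D s)) has_vector_derivative
        exp (?c * of_real r) * (exp (- ?c * of_real s) * ?D' + - ?c * exp (- ?c * of_real s) * ?D s)) (at s within {0..r})"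
      by (rule has_vector_derivative_mult_right[OF has_vector_derivative_mult[OF exp_of_real_has_vector_derivative D]])
    moreover have e: "exp (?c * of_real r) * (exp (- ?c * of_real s) * X) = exp (?c * of_real (r - s)) * X" for s X
    proof -
      have "exp (?c * of_real r) * exp (- ?c * of_real s) = exp (?c * of_real (r - s))"
        unfolding exp_add[symmetric] by (simp add: algebra_simps)
      from arg_cong[OF this, of "\<lambda>u. u * X"] show ?thesis by (simp only: mult.assoc)
    qed
    moreover have "exp (- ?c * of_real s) * ?D' + - ?c * exp (- ?c * of_real s) * ?D s
        = exp (- ?c * of_real s) * (2 * z * divdiff S (?E s))"
      unfolding rec by (simp add: algebra_simps)
    ultimately have "((\<lambda>s. exp (?c * of_real (r - s)) * ?D s) has_vector_derivative
      exp (?c * of_real (r - s)) * (2 * z * divdiff S (?E s))) (at s within {0..r})"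
      by (simp only:)
    then show ?thesis by (simp only: mult.assoc mult.left_commute)
  qed
  then have "((\<lambda>s. 2 * z * exp (?c * of_real (r - s)) * divdiff S (?E s)) has_integral
      exp (?c * of_real (r - r)) * ?D r - exp (?c * of_real (r - 0)) * ?D 0) {0..r}"
    by (intro fundamental_theorem_of_calculus r)
  \<comment> \<open>At \<open>s = 0\<close> the function is constant and there are at least two
    nodes, so no initial term survives.\<close>
  moreover have "?D 0 = 0"
    using S by (simp add: divdiff_const Suc_le_eq card_gt_0_iff)
  ultimately show ?thesis by simp
qed

text \<open>Every divided difference of \<open>t \<mapsto> e\<^bsup>2tz\<^esup>\<close> at \<open>n\<close> nodes is \<open>(2z)\<^bsup>n-1\<^esup>\<close> times the Laplace transform of a
  positive measure (Hermite--Genocchi); this is the resulting comparison of \<open>z\<close> with its real part.\<close>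

lemma divdiff_exp_real_part:
  assumes "finite S" "S \<noteq> {}" "r \<ge> 0"
  shows "\<bar>Re z\<bar> ^ (card S - 1) * cmod (divdiff S (\<lambda>t. exp (2 * of_real t * z * of_real r)))
    \<le> cmod z ^ (card S - 1) * (sgn (Re z) ^ (card S - 1) * divdiff S (\<lambda>t. exp (2 * t * Re z * r)))"
  using assms
proof (induction S arbitrary: r rule: finite_ne_induct)
  case (singleton a)
  then show ?case by simp
next
  case (insert a S)
  define x where "x = Re z"
  define n where "n = card S - 1"
  have card: "card (insert a S) - 1 = Suc n"
    using insert.hyps by (simp add: n_def card_gt_0_iff)
  let ?D = "\<lambda>S z s. divdiff S (\<lambda>t. exp (2 * of_real t * z * of_real s))"
  have eqz: "((\<lambda>s. \<bar>x\<bar> ^ Suc n *\<^sub>R (2 * z * exp (2 * of_real a * z * of_real (r - s)) * ?D S z s)) has_integral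
      \<bar>x\<bar> ^ Suc n *\<^sub>R ?D (insert a S) z r) {0..r}"
    by (intro has_integral_cmul divdiff_exp_integral insert.hyps insert.prems)
  have eqx: "((\<lambda>s. cmod z ^ Suc n * sgn x ^ Suc n * (2 * x * exp (2 * of_real a * x * of_real (r - s)) * ?D S x s)) has_integral
      cmod z ^ Suc n * sgn x ^ Suc n * ?D (insert a S) x r) {0..r}"
    by (intro has_integral_mult_right divdiff_exp_integral insert.hyps insert.prems)
  \<comment> \<open>The exponential in the kernel has the same modulus at \<open>z\<close> as at
    \<open>x\<close>, so the comparison passes through the integral;
    \<open>x * sgn x = \<bar>x\<bar>\<close> supplies the additional sign.\<close>
  have "norm (integral {0..r} (\<lambda>s. \<bar>x\<bar> ^ Suc n *\<^sub>R (2 * z * exp (2 * of_real a * z * of_real (r - s)) * ?D S z s)))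
     \<le> integral {0..r} (\<lambda>s. cmod z ^ Suc n * sgn x ^ Suc n * (2 * x * exp (2 * of_real a * x * of_real (r - s)) * ?D S x s))"
  proof (rule integral_norm_bound_integral)
    fix s assume s: "s \<in> {0..r}"
    have "norm (\<bar>x\<bar> ^ Suc n *\<^sub>R (2 * z * exp (2 * of_real a * z * of_real (r - s)) * ?D S z s))
        = 2 * cmod z * \<bar>x\<bar> * exp (2 * a * x * (r - s)) * (\<bar>x\<bar> ^ n * cmod (?D S z s))"
      by (simp add: norm_mult x_def)
    also have "\<dots> \<le> 2 * cmod z * \<bar>x\<bar> * exp (2 * a * x * (r - s)) * (cmod z ^ n * (sgn x ^ n * ?D S x s))"
      using insert.IH[of s] s by (intro mult_left_mono) (auto simp: x_def n_def)
    also have "\<dots> = cmod z ^ Suc n * sgn x ^ Suc n * (2 * x * exp (2 * of_real a * x * of_real (r - s)) * ?D S x s)"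
      by (simp add: abs_sgn)
    finally show "norm (\<bar>x\<bar> ^ Suc n *\<^sub>R (2 * z * exp (2 * of_real a * z * of_real (r - s)) * ?D S z s))
      \<le> cmod z ^ Suc n * sgn x ^ Suc n * (2 * x * exp (2 * of_real a * x * of_real (r - s)) * ?D S x s)" .
  qed (rule has_integral_integrable[OF eqz] has_integral_integrable[OF eqx])+
  then have "norm (\<bar>x\<bar> ^ Suc n *\<^sub>R ?D (insert a S) z r) \<le> cmod z ^ Suc n * sgn x ^ Suc n * ?D (insert a S) x r"
    by (simp only: integral_unique[OF eqz] integral_unique[OF eqx])
  then show ?case
    unfolding card x_def[symmetric] by (simp add: abs_mult power_abs mult.assoc)
qed

section \<open>Gauss--Hermite quadrature of exponentials\<close>

text \<open>\<open>hermite_moment j n = \<pi>\<^bsup>-1/2\<^esup> \<integral> t\<^sup>j H\<^sub>n(t) e\<^bsup>-t^2\<^esup> dt\<close>\<close>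

definition hermite_moment :: "nat \<Rightarrow> nat \<Rightarrow> real" where
  "hermite_moment j n = (if n \<le> j \<and> even (j - n)
     then fact j / (fact ((j - n) div 2) * 4 ^ ((j - n) div 2)) else 0)"

lemma hermite_moment_eq: "hermite_moment (n + 2 * i) n = fact (n + 2 * i) / (fact i * 4 ^ i)"
  by (simp add: hermite_moment_def)

lemma hermite_moment_nonneg: "hermite_moment j n \<ge> 0"
  by (simp add: hermite_moment_def)

text \<open>This is t H_n = H_(n+1)/2 + n H_(n-1) integrated against t^j, checked on the closed
  form. \<open>quad_power_hermite_rec\<close> is its discrete counterpart.\<close>

lemma hermite_moment_Suc:
  "hermite_moment (Suc j) n = hermite_moment j (Suc n) / 2 + real n * hermite_moment j (n - 1)"
proof (cases "n \<le> Suc j \<and> even (Suc j - n)")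
  case False
  then have "hermite_moment j (Suc n) = 0"
    by (auto simp: hermite_moment_def Suc_diff_le)
  moreover have "n = 0 \<or> hermite_moment j (n - 1) = 0"
    using False by (cases n) (auto simp: hermite_moment_def)
  ultimately show ?thesis using False by (auto simp: hermite_moment_def)
next
  case True
  then obtain i where i: "Suc j = n + 2 * i"
    by (metis evenE le_add_diff_inverse)
  show ?thesis
  proof (cases i)
    case 0
    then show ?thesis using i by (auto simp: hermite_moment_def)
  next
    case (Suc k)
    then have j: "j = Suc n + 2 * k" using i by simp
    have 1: "hermite_moment j (Suc n) = fact j / (fact k * 4 ^ k)"
      unfolding j by (rule hermite_moment_eq)
    have 2: "real n * hermite_moment j (n - 1) = real n * fact j / (fact (Suc k) * 4 ^ Suc k)"
    proof (cases n)
      case (Suc m)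
      then have "j = m + 2 * Suc k" using j by simp
      then show ?thesis using Suc by (simp only: hermite_moment_eq diff_Suc_1 times_divide_eq_right)
    qed simp
    have 3: "hermite_moment (Suc j) n = fact (Suc j) / (fact (Suc k) * 4 ^ Suc k)"
      unfolding i Suc by (rule hermite_moment_eq)
    define C :: real where "C = fact k * 4 ^ k"
    have C: "C > 0" "fact (Suc k) * 4 ^ Suc k = 4 * (real k + 1) * C"
      by (simp_all add: C_def algebra_simps)
    have "fact (Suc j) = (real n + 2 * (real k + 1)) * fact j"
      by (simp add: j algebra_simps)
    then show ?thesis
      unfolding 1 2 3 C(2) C_def[symmetric] using C(1) by (simp add: divide_simps) (simp add: algebra_simps)
  qed
qed

text \<open>The Gaussian mean of e^(2tx) H_n(t), expanded in powers of x; its value majorises the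
  series of the divided difference.\<close>

lemma hermite_moment_sums:
  "(\<lambda>j. (2 * x) ^ j / fact j * hermite_moment j n) sums ((2 * x) ^ n * exp (x\<^sup>2))"
proof -
  have "(\<lambda>i. (2 * x) ^ n * ((x\<^sup>2) ^ i /\<^sub>R fact i)) sums ((2 * x) ^ n * exp (x\<^sup>2))"
    by (intro sums_mult exp_converges)
  also have "(\<lambda>i. (2 * x) ^ n * ((x\<^sup>2) ^ i /\<^sub>R fact i))
      = (\<lambda>i. (2 * x) ^ (n + 2 * i) / fact (n + 2 * i) * hermite_moment (n + 2 * i) n)"
    by (simp add: fun_eq_iff hermite_moment_eq power_add power_mult power_mult_distrib divide_simps)
  also have "\<dots> sums ((2 * x) ^ n * exp (x\<^sup>2)) \<longleftrightarrow> ?thesis"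
  proof (rule sums_mono_reindex[where g = "\<lambda>i. n + 2 * i"])
    show "strict_mono (\<lambda>i. n + 2 * i)" by (auto simp: strict_mono_def)
    fix j assume "j \<notin> range (\<lambda>i. n + 2 * i)"
    then have "\<not> (n \<le> j \<and> even (j - n))"
      by (metis evenE le_add_diff_inverse rangeI)
    then show "(2 * x) ^ j / fact j * hermite_moment j n = 0"
      by (auto simp: hermite_moment_def)
  qed
  finally show ?thesis .
qed

lemma integral_power_mult_complement:
  assumes "n > 0"
  shows "((\<lambda>s::real. s ^ n * (1 - s) ^ (n - 1)) has_integral fact n * fact (n - 1) / fact (2 * n)) {0..1}"
proof -
  \<comment> \<open>The open interval matters for \<open>n = 1\<close>: at the endpoint 1,
    \<open>0 powr 0 = 0\<close> but \<open>0 ^ 0 = 1\<close>.\<close>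
  have "((\<lambda>t. t powr (real (Suc n) - 1) * (1 - t) powr (real n - 1)) has_integral Beta (real (Suc n)) (real n)) {0<..<1}"
    using has_integral_Beta_real[of "real (Suc n)" "real n"] assms
    by (simp add: has_integral_Icc_iff_Ioo)
  also have "?this \<longleftrightarrow> ((\<lambda>s::real. s ^ n * (1 - s) ^ (n - 1)) has_integral Beta (real (Suc n)) (real n)) {0<..<1}"
  proof (rule has_integral_cong)
    fix t :: real assume "t \<in> {0<..<1}"
    moreover have "real n - 1 = real (n - 1)" using assms by simp
    ultimately show "t powr (real (Suc n) - 1) * (1 - t) powr (real n - 1) = t ^ n * (1 - t) ^ (n - 1)"
      by (simp add: powr_realpow del: of_nat_diff)
  qed
  also have "Beta (real (Suc n)) (real n) = fact n * fact (n - 1) / fact (2 * n)"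
  proof -
    have "real (Suc n) = 1 + real n" "real n = 1 + real (n - 1)"
      "real (Suc n) + real n = 1 + real (2 * n)" using assms by auto
    then show ?thesis unfolding Beta_def using Gamma_fact by metis
  qed
  finally show ?thesis by (simp add: has_integral_Icc_iff_Ioo)
qed

section \<open>Quadrature at the zeros: exactness and domination by the true moments\<close>

locale hermite_nodes =
  fixes N :: nat and S :: "real set"
  assumes N_pos: "N > 0" and finite: "finite S" and card: "card S = N"
    and root: "a \<in> S \<Longrightarrow> hermite N a = 0"
begin

text \<open>The Gauss--Hermite weights, normalised to have sum \<open>1\<close>.\<close>

definition weight :: "real \<Rightarrow> real" where
  "weight a = fact (N - 1) / (hermite (N - 1) a * (\<Prod>b\<in>S - {a}. a - b))"

definition quad :: "(real \<Rightarrow> 'a::real_vector) \<Rightarrow> 'a" where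
  "quad f = (\<Sum>a\<in>S. weight a *\<^sub>R f a)"

lemma quad_scaleR: "quad (\<lambda>t. c *\<^sub>R f t) = c *\<^sub>R quad f"
  by (simp add: quad_def scaleR_sum_right mult_ac)

lemma quad_add: "quad (\<lambda>t. f t + g t) = quad f + quad g"
  by (simp add: quad_def scaleR_add_right sum.distrib)

lemma quad_hermite_root: "quad (\<lambda>t. hermite N t *\<^sub>R f t) = 0"
  by (simp add: quad_def root)

text \<open>The denominator of \<open>weight\<close> contains H_(N-1)(a), so multiplying by H_(N-1)
  leaves the Lagrange coefficients of a divided difference.\<close>

lemma quad_hermite_pred: "quad (\<lambda>t. hermite (N - 1) t *\<^sub>R f t) = fact (N - 1) *\<^sub>R divdiff S f"
proof -
  have "hermite (N - 1) a \<noteq> 0" if "a \<in> S" for a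
    using hermite_consecutive_nonzero[of "N - 1" a] root[OF that] N_pos by auto
  then show ?thesis
    unfolding quad_def divdiff_def scaleR_sum_right weight_def by (intro sum.cong) auto
qed

lemma quad_power_hermite_rec:
  "quad (\<lambda>t. t ^ Suc j * hermite n t)
    = quad (\<lambda>t. t ^ j * hermite (Suc n) t) / 2 + real n * quad (\<lambda>t. t ^ j * hermite (n - 1) t)"
proof -
  have "quad (\<lambda>t. t ^ Suc j * hermite n t)
     = quad (\<lambda>t. (1 / 2) *\<^sub>R (t ^ j * hermite (Suc n) t) + real n *\<^sub>R (t ^ j * hermite (n - 1) t))"
    by (simp add: hermite_Suc algebra_simps)
  then show ?thesis by (simp only: quad_add quad_scaleR) simp
qed

text \<open>Downward induction from n = N - 1, where H_N vanishes at the nodes and H_(N-1) yields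
  the divided difference of t^j. The recurrence for t^(j+1) H_(n+1) then determines t^j H_n; it also
  involves t^j H_(n+2), whence the second conjunct.\<close>

lemma quad_power_hermite_low:
  assumes "n < N"
  shows "\<forall>j\<le>n. quad (\<lambda>t. t ^ j * hermite n t) = (if j = n then fact n else 0) \<and>
           quad (\<lambda>t. t ^ j * hermite (Suc n) t) = 0"
proof -
  have "n \<le> N - 1" using assms by simp
  then show ?thesis
  proof (induction rule: inc_induct)
    case base
    show ?case
      using quad_hermite_root[of "\<lambda>t. t ^ _"] quad_hermite_pred[of "\<lambda>t. t ^ _"]
        divdiff_power[OF finite] N_pos
      by (auto simp: mult.commute card)
  next
    case (step n)
    show ?case
    proof (intro allI impI)
      fix j assume "j \<le> n"
      then have "quad (\<lambda>t. t ^ Suc j * hermite (Suc n) t) = (if j = n then fact (Suc n) else 0)"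
        "quad (\<lambda>t. t ^ j * hermite (Suc (Suc n)) t) = 0"
        "quad (\<lambda>t. t ^ j * hermite (Suc n) t) = 0"
        using step.IH[rule_format, of "Suc j"] step.IH[rule_format, of j] by auto
      moreover from this have "real (Suc n) * quad (\<lambda>t. t ^ j * hermite n t) = (if j = n then fact (Suc n) else 0)"
        using quad_power_hermite_rec[of j "Suc n"] by simp
      then have "quad (\<lambda>t. t ^ j * hermite n t) = (if j = n then fact n else 0)"
        by (auto simp del: of_nat_Suc split: if_splits)
      ultimately show "quad (\<lambda>t. t ^ j * hermite n t) = (if j = n then fact n else 0) \<and>
           quad (\<lambda>t. t ^ j * hermite (Suc n) t) = 0"
        by simp
    qed
  qed
qed

lemma quad_hermite: "n < N \<Longrightarrow> quad (hermite n) = (if n = 0 then 1 else 0)"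
  using quad_power_hermite_low[of n] by auto

text \<open>Quadratures and moments obey the same recurrence in j, with nonnegative coefficients,
  and agree at j = 0. The quadrature is in addition reset to 0 at n = N, which can only make it
  smaller.\<close>

lemma quad_power_hermite_bounds:
  "n \<le> N \<Longrightarrow> 0 \<le> quad (\<lambda>t. t ^ j * hermite n t) \<and> quad (\<lambda>t. t ^ j * hermite n t) \<le> hermite_moment j n"
proof (induction j arbitrary: n)
  case 0
  then show ?case
    using quad_hermite_root[of "\<lambda>_. 1::real"] quad_hermite[of n]
    by (cases "n = N") (auto simp: hermite_moment_def)
next
  case (Suc j)
  show ?case
  proof (cases "n = N")
    case True
    then show ?thesis
      using quad_hermite_root[of "\<lambda>t. t ^ Suc j"] hermite_moment_nonneg by (simp add: mult.commute)
  next
    case False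
    then have "Suc n \<le> N" "n - 1 \<le> N" using Suc.prems by auto
    from Suc.IH[OF this(1)] Suc.IH[OF this(2)] show ?thesis
      unfolding quad_power_hermite_rec hermite_moment_Suc
      by (auto intro!: add_mono add_nonneg_nonneg mult_left_mono)
  qed
qed

section \<open>The quadrature error for exponentials\<close>

lemma divdiff_exp_real_bound:
  "\<bar>divdiff S (\<lambda>t. exp (2 * t * x))\<bar> \<le> (2 * \<bar>x\<bar>) ^ (N - 1) * exp (x\<^sup>2) / fact (N - 1)"
proof -
  let ?V = "\<lambda>j. divdiff S (\<lambda>t. t ^ j)"
  have "(\<lambda>j. \<Sum>a\<in>S. (1 / (\<Prod>b\<in>S - {a}. a - b)) *\<^sub>R ((2 * a * x) ^ j /\<^sub>R fact j)) sums
      divdiff S (\<lambda>t. exp (2 * t * x))"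
    unfolding divdiff_def by (intro sums_sum sums_scaleR_right exp_converges)
  also have "(\<lambda>j. \<Sum>a\<in>S. (1 / (\<Prod>b\<in>S - {a}. a - b)) *\<^sub>R ((2 * a * x) ^ j /\<^sub>R fact j)) =
      (\<lambda>j. (2 * x) ^ j / fact j * ?V j)"
    by (simp add: fun_eq_iff divdiff_def sum_distrib_left power_mult_distrib divide_simps mult_ac)
  finally have D: "(\<lambda>j. (2 * x) ^ j / fact j * ?V j) sums divdiff S (\<lambda>t. exp (2 * t * x))" .
  have "(\<lambda>j. (2 * \<bar>x\<bar>) ^ j / fact j * hermite_moment j (N - 1) / fact (N - 1)) sums
      ((2 * \<bar>x\<bar>) ^ (N - 1) * exp (\<bar>x\<bar>\<^sup>2) / fact (N - 1))"
    by (intro sums_divide hermite_moment_sums)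
  note M = this
  have le: "\<bar>(2 * x) ^ j / fact j * ?V j\<bar> \<le> (2 * \<bar>x\<bar>) ^ j / fact j * hermite_moment j (N - 1) / fact (N - 1)" for j
  proof -
    have "fact (N - 1) * ?V j = quad (\<lambda>t. t ^ j * hermite (N - 1) t)"
      using quad_hermite_pred[of "\<lambda>t. t ^ j"] by (simp add: mult.commute)
    then have "fact (N - 1) * \<bar>?V j\<bar> \<le> hermite_moment j (N - 1)"
      using quad_power_hermite_bounds[of "N - 1" j] abs_mult[of "fact (N - 1)" "?V j"] by simp
    then have "\<bar>?V j\<bar> \<le> hermite_moment j (N - 1) / fact (N - 1)"
      by (simp add: field_simps)
    then show ?thesis
      by (simp add: abs_mult power_abs mult_left_mono divide_right_mono flip: times_divide_eq_right)
  qed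
  have "divdiff S (\<lambda>t. exp (2 * t * x)) \<le> (2 * \<bar>x\<bar>) ^ (N - 1) * exp (\<bar>x\<bar>\<^sup>2) / fact (N - 1)"
    using le by (intro sums_le[OF _ D M]) (simp only: abs_le_iff)
  moreover have "- divdiff S (\<lambda>t. exp (2 * t * x)) \<le> (2 * \<bar>x\<bar>) ^ (N - 1) * exp (\<bar>x\<bar>\<^sup>2) / fact (N - 1)"
    using le by (intro sums_le[OF _ sums_minus[OF D] M]) (simp only: abs_le_iff)
  ultimately show ?thesis by (simp add: abs_le_iff)
qed

text \<open>The power of |Re z| on the left of \<open>divdiff_exp_real_part\<close> cancels against
  the same power in the bound at Re z. The imaginary axis, where it cannot be cancelled, follows by
  continuity.\<close>

lemma divdiff_exp_bound:
  "cmod (divdiff S (\<lambda>t. exp (2 * of_real t * z))) \<le> (2 * cmod z) ^ (N - 1) * exp ((Re z)\<^sup>2) / fact (N - 1)"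
proof -
  let ?D = "\<lambda>z. divdiff S (\<lambda>t. exp (2 * of_real t * z))"
  let ?B = "\<lambda>z. (2 * cmod z) ^ (N - 1) * exp ((Re z)\<^sup>2) / fact (N - 1)"
  have nz: "cmod (?D z) \<le> ?B z" if x: "Re z \<noteq> 0" for z
  proof -
    have "S \<noteq> {}" using card N_pos by auto
    have "\<bar>Re z\<bar> ^ (N - 1) * cmod (?D z) \<le>
        cmod z ^ (N - 1) * (sgn (Re z) ^ (N - 1) * divdiff S (\<lambda>t. exp (2 * t * Re z)))"
      using divdiff_exp_real_part[OF finite \<open>S \<noteq> {}\<close>, of 1 z] by (simp add: card)
    also have "\<dots> \<le> cmod z ^ (N - 1) * \<bar>sgn (Re z) ^ (N - 1) * divdiff S (\<lambda>t. exp (2 * t * Re z))\<bar>"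
      by (intro mult_left_mono abs_ge_self) simp
    also have "\<dots> = cmod z ^ (N - 1) * \<bar>divdiff S (\<lambda>t. exp (2 * t * Re z))\<bar>"
      using x by (simp add: abs_mult power_abs abs_sgn_eq)
    also have "\<dots> \<le> cmod z ^ (N - 1) * ((2 * \<bar>Re z\<bar>) ^ (N - 1) * exp ((Re z)\<^sup>2) / fact (N - 1))"
      by (intro mult_left_mono divdiff_exp_real_bound) simp
    also have "\<dots> = \<bar>Re z\<bar> ^ (N - 1) * ?B z"
      by (simp add: power_mult_distrib mult_ac)
    finally show ?thesis
      by (rule mult_left_le_imp_le) (use x in simp)
  qed
  show ?thesis
  proof (cases "Re z = 0")
    case True
    have lim: "(\<lambda>n. z + of_real (inverse (real (Suc n)))) \<longlonglongrightarrow> z"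
      using tendsto_add[OF tendsto_const[of z] tendsto_of_real[OF LIMSEQ_inverse_real_of_nat, where 'a = complex]]
      by simp
    show ?thesis
    proof (rule LIMSEQ_le)
      show "(\<lambda>n. cmod (?D (z + of_real (inverse (real (Suc n)))))) \<longlonglongrightarrow> cmod (?D z)"
        unfolding divdiff_def by (intro tendsto_intros lim)
      show "(\<lambda>n. ?B (z + of_real (inverse (real (Suc n))))) \<longlonglongrightarrow> ?B z"
        by (intro tendsto_intros lim) auto
      show "\<exists>M. \<forall>n\<ge>M. cmod (?D (z + of_real (inverse (real (Suc n))))) \<le> ?B (z + of_real (inverse (real (Suc n))))"
        using True by (intro exI allI impI nz) auto
    qed
  qed (rule nz)
qed

text \<open>\<open>exp (z\<^sup>2)\<close> is the exact mean of e^(2tz) under the density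
  e^(-t^2)/sqrt(pi).\<close>

definition exp_error :: "complex \<Rightarrow> complex" where
  "exp_error z = exp (z\<^sup>2) - quad (\<lambda>t. exp (2 * of_real t * z))"

text \<open>With \<open>p\<^sub>n(w) = w\<^sup>n e\<^bsup>w^2\<^esup> / n!\<close> and \<open>\<phi>\<^sub>n(w)\<close> the quadrature of \<open>H\<^sub>n(t) e\<^bsup>2tw\<^esup>\<close>, the sum
  \<open>\<Sum>n<N. p\<^sub>n(sz) \<phi>\<^sub>n((1-s)z)\<close> runs from the quadrature of \<open>e\<^bsup>2tz\<^esup>\<close> at \<open>s = 0\<close> to \<open>e\<^bsup>z^2\<^esup>\<close> at \<open>s = 1\<close>,
  and its derivative in \<open>s\<close> telescopes.\<close>

lemma exp_error_integral:
  "((\<lambda>s. 2 * z * (of_real s * z) ^ N * exp ((of_real s * z)\<^sup>2)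
        * divdiff S (\<lambda>t. exp (2 * of_real t * (of_real (1 - s) * z)))) has_integral exp_error z) {0..1}"
proof -
  define p :: "nat \<Rightarrow> complex \<Rightarrow> complex" where "p n w = w ^ n / fact n * exp (w\<^sup>2)" for n w
  define \<phi> :: "nat \<Rightarrow> complex \<Rightarrow> complex" where
    "\<phi> n w = quad (\<lambda>t. hermite n t *\<^sub>R exp (2 * of_real t * w))" for n w
  define p' where "p' n w = (if n = 0 then 0 else p (n - 1) w) + 2 * of_nat (Suc n) * p (Suc n) w" for n w
  define \<phi>' where "\<phi>' n w = \<phi> (Suc n) w + 2 * of_nat n * \<phi> (n - 1) w" for n w
  have p: "(p n has_field_derivative p' n w) (at w)" for n w
  proof -
    have "((\<lambda>w. w ^ n / fact n * exp (w\<^sup>2)) has_field_derivative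
        (of_nat n * w ^ (n - 1) / fact n * exp (w\<^sup>2) + w ^ n / fact n * (exp (w\<^sup>2) * (2 * w)))) (at w)"
      by (auto intro!: derivative_eq_intros simp: add_divide_distrib mult_ac)
    moreover have "p n = (\<lambda>w. w ^ n / fact n * exp (w\<^sup>2))" by (simp add: fun_eq_iff p_def)
    moreover have "of_nat n * w ^ (n - 1) / fact n * exp (w\<^sup>2) + w ^ n / fact n * (exp (w\<^sup>2) * (2 * w)) = p' n w"
      by (cases n) (simp_all add: p'_def p_def fact_Suc del: of_nat_Suc)
    ultimately show ?thesis by simp
  qed
  have \<phi>: "(\<phi> n has_field_derivative \<phi>' n w) (at w)" for n w
  proof -
    have "((\<lambda>w. \<Sum>a\<in>S. of_real (weight a * hermite n a) * exp (2 * of_real a * w)) has_field_derivative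
        (\<Sum>a\<in>S. of_real (weight a * hermite n a) * (exp (2 * of_real a * w) * (2 * of_real a)))) (at w)"
      by (auto intro!: derivative_eq_intros sum.cong simp: mult_ac)
    moreover have "\<phi> n = (\<lambda>w. \<Sum>a\<in>S. of_real (weight a * hermite n a) * exp (2 * of_real a * w))"
      by (simp add: fun_eq_iff \<phi>_def quad_def scaleR_conv_of_real mult.assoc)
    moreover have "(\<Sum>a\<in>S. of_real (weight a * hermite n a) * (exp (2 * of_real a * w) * (2 * of_real a))) = \<phi>' n w"
      unfolding \<phi>'_def \<phi>_def quad_def sum_distrib_left sum.distrib[symmetric] hermite_Suc
      by (intro sum.cong refl) (simp add: scaleR_conv_of_real algebra_simps)
    ultimately show ?thesis by simp
  qed
  \<comment> \<open>The recurrences of \<open>p\<close> and \<open>\<phi>\<close> are adjoint, so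
    interior terms cancel. For \<open>m = N - 1\<close>, one of the two boundary terms contains H_N
    and vanishes at the nodes.\<close>
  have telescope: "(\<Sum>n<Suc m. p' n u * \<phi> n w - p n u * \<phi>' n w) =
      2 * of_nat (Suc m) * p (Suc m) u * \<phi> m w - p m u * \<phi> (Suc m) w" for m u w
    by (induction m) (simp_all add: p'_def \<phi>'_def algebra_simps)
  define W where "W s = (\<Sum>n<N. p n (s * z) * \<phi> n ((1 - s) * z))" for s
  have \<phi>N: "\<phi> N w = 0" for w
    unfolding \<phi>_def by (rule quad_hermite_root)
  have \<phi>pred: "\<phi> (N - 1) w = fact (N - 1) * divdiff S (\<lambda>t. exp (2 * of_real t * w))" for w
    unfolding \<phi>_def quad_hermite_pred by (simp add: scaleR_conv_of_real)
  have "(W has_field_derivative (2 * z * (s * z) ^ N * exp ((s * z)\<^sup>2)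
        * divdiff S (\<lambda>t. exp (2 * of_real t * ((1 - s) * z))))) (at s)" for s
  proof -
    have "((\<lambda>s. s * z) has_field_derivative z) (at s)" "((\<lambda>s. (1 - s) * z) has_field_derivative - z) (at s)"
      by (auto intro!: derivative_eq_intros)
    then have "(W has_field_derivative (\<Sum>n<N. p n (s * z) * (\<phi>' n ((1 - s) * z) * (- z)) + p' n (s * z) * z * \<phi> n ((1 - s) * z))) (at s)"
      unfolding W_def
      by (intro DERIV_sum DERIV_mult' DERIV_chain2[OF p] DERIV_chain2[OF \<phi>])
    moreover have "(\<Sum>n<N. p n (s * z) * (\<phi>' n ((1 - s) * z) * (- z)) + p' n (s * z) * z * \<phi> n ((1 - s) * z))
       = z * (\<Sum>n<Suc (N - 1). p' n (s * z) * \<phi> n ((1 - s) * z) - p n (s * z) * \<phi>' n ((1 - s) * z))"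
      using N_pos by (simp add: sum_distrib_left algebra_simps)
    moreover have "\<dots> = z * (2 * of_nat N * p N (s * z) * \<phi> (N - 1) ((1 - s) * z))"
      unfolding telescope using N_pos by (simp add: \<phi>N)
    moreover have "\<dots> = 2 * z * (s * z) ^ N * exp ((s * z)\<^sup>2) * divdiff S (\<lambda>t. exp (2 * of_real t * ((1 - s) * z)))"
    proof -
      have "(fact N :: complex) = of_nat N * fact (N - 1)"
        using N_pos by (simp add: fact_reduce)
      then have "of_nat N * p N (s * z) * fact (N - 1) = (s * z) ^ N * exp ((s * z)\<^sup>2)"
        using N_pos by (simp add: p_def)
      moreover have "z * (2 * of_nat N * p N (s * z) * \<phi> (N - 1) ((1 - s) * z)) =
        2 * z * (of_nat N * p N (s * z) * fact (N - 1)) * divdiff S (\<lambda>t. exp (2 * of_real t * ((1 - s) * z)))"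
        unfolding \<phi>pred by (simp only: mult_ac)
      ultimately show ?thesis by simp
    qed
    ultimately show ?thesis by (simp only:)
  qed
  then have "((\<lambda>s. W (of_real s)) has_vector_derivative (2 * z * (of_real s * z) ^ N * exp ((of_real s * z)\<^sup>2)
        * divdiff S (\<lambda>t. exp (2 * of_real t * (of_real (1 - s) * z))))) (at s within {0..1})" for s
    using has_vector_derivative_real_field by fastforce
  then have "((\<lambda>s. 2 * z * (of_real s * z) ^ N * exp ((of_real s * z)\<^sup>2)
        * divdiff S (\<lambda>t. exp (2 * of_real t * (of_real (1 - s) * z)))) has_integral W (of_real 1) - W (of_real 0)) {0..1}"
    by (intro fundamental_theorem_of_calculus) auto
  moreover have "W 0 = quad (\<lambda>t. exp (2 * of_real t * z))"
  proof -
    have "W 0 = (\<Sum>n<N. if n = 0 then \<phi> 0 z else 0)"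
      unfolding W_def by (intro sum.cong) (auto simp: p_def)
    then show ?thesis using N_pos by (simp add: \<phi>_def hermite_0)
  qed
  \<comment> \<open>At \<open>w = 0\<close> the quadratures are those of H_n alone, and exactness
    leaves only \<open>n = 0\<close>.\<close>
  moreover have "W 1 = exp (z\<^sup>2)"
  proof -
    have "\<phi> n 0 = of_real (quad (hermite n))" for n
      by (simp add: \<phi>_def quad_def scaleR_conv_of_real)
    then have "W 1 = (\<Sum>n<N. if n = 0 then exp (z\<^sup>2) else 0)"
      unfolding W_def by (intro sum.cong) (auto simp: p_def quad_hermite)
    then show ?thesis using N_pos by simp
  qed
  ultimately show ?thesis by (simp add: exp_error_def)
qed

text \<open>The Gaussian factors combine to exp((s^2 + (1-s)^2) (Re z)^2), at most exp((Re z)^2) on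
  [0,1]; the remaining s-integral is a Beta integral.\<close>

lemma cmod_exp_error_le:
  "cmod (exp_error z) \<le> 2 ^ N * fact N / fact (2 * N) * cmod z ^ (2 * N) * exp ((Re z)\<^sup>2)"
proof -
  let ?F = "\<lambda>s. 2 * z * (of_real s * z) ^ N * exp ((of_real s * z)\<^sup>2)
        * divdiff S (\<lambda>t. exp (2 * of_real t * (of_real (1 - s) * z)))"
  let ?c = "2 ^ N * cmod z ^ (2 * N) * exp ((Re z)\<^sup>2) / fact (N - 1)"
  have G: "((\<lambda>s. ?c * (s ^ N * (1 - s) ^ (N - 1))) has_integral ?c * (fact N * fact (N - 1) / fact (2 * N))) {0..1}"
    by (intro has_integral_mult_right integral_power_mult_complement N_pos)
  have "norm (integral {0..1} ?F) \<le> integral {0..1} (\<lambda>s. ?c * (s ^ N * (1 - s) ^ (N - 1)))"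
  proof (rule integral_norm_bound_integral)
    fix s :: real assume "s \<in> {0..1}"
    then have s: "0 \<le> s" "s \<le> 1" by auto
    have "cmod (divdiff S (\<lambda>t. exp (2 * of_real t * (of_real (1 - s) * z))))
      \<le> (2 * cmod (of_real (1 - s) * z)) ^ (N - 1) * exp ((Re (of_real (1 - s) * z))\<^sup>2) / fact (N - 1)"
      by (rule divdiff_exp_bound)
    also have "\<dots> = 2 ^ (N - 1) * (1 - s) ^ (N - 1) * cmod z ^ (N - 1) * exp ((1 - s)\<^sup>2 * (Re z)\<^sup>2) / fact (N - 1)"
      using s by (simp add: norm_mult power_mult_distrib del: of_real_diff)
    finally have D: "cmod (divdiff S (\<lambda>t. exp (2 * of_real t * (of_real (1 - s) * z)))) \<le> \<dots>" .
    have "Re ((of_real s * z)\<^sup>2) \<le> s\<^sup>2 * (Re z)\<^sup>2"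
      by (simp add: power2_eq_square algebra_simps mult_nonneg_nonneg s)
    then have E: "cmod (exp ((of_real s * z)\<^sup>2)) \<le> exp (s\<^sup>2 * (Re z)\<^sup>2)"
      by simp
    have "norm (?F s) = 2 * cmod z * (s * cmod z) ^ N * (cmod (exp ((of_real s * z)\<^sup>2))
        * cmod (divdiff S (\<lambda>t. exp (2 * of_real t * (of_real (1 - s) * z)))))"
      using s by (simp add: norm_mult norm_power)
    also have "\<dots> \<le> 2 * cmod z * (s * cmod z) ^ N * (exp (s\<^sup>2 * (Re z)\<^sup>2)
        * (2 ^ (N - 1) * (1 - s) ^ (N - 1) * cmod z ^ (N - 1) * exp ((1 - s)\<^sup>2 * (Re z)\<^sup>2) / fact (N - 1)))"
      using s by (intro mult_left_mono mult_mono D E) auto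
    also have "\<dots> = (2 * 2 ^ (N - 1)) * (cmod z * cmod z ^ (N - 1) * cmod z ^ N) * exp ((s\<^sup>2 + (1 - s)\<^sup>2) * (Re z)\<^sup>2)
        / fact (N - 1) * (s ^ N * (1 - s) ^ (N - 1))"
      by (simp add: power_mult_distrib exp_add distrib_right)
    also have "\<dots> = 2 ^ N * cmod z ^ (2 * N) * exp ((s\<^sup>2 + (1 - s)\<^sup>2) * (Re z)\<^sup>2)
        / fact (N - 1) * (s ^ N * (1 - s) ^ (N - 1))"
      using N_pos by (simp add: power_minus_mult power_add[symmetric] mult_2 flip: power_Suc)
    also have "\<dots> \<le> 2 ^ N * cmod z ^ (2 * N) * exp ((Re z)\<^sup>2) / fact (N - 1) * (s ^ N * (1 - s) ^ (N - 1))"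
    proof -
      have "s\<^sup>2 + (1 - s)\<^sup>2 \<le> 1"
        using s mult_nonneg_nonneg[of s "1 - s"] by (simp add: power2_eq_square algebra_simps)
      then have "(s\<^sup>2 + (1 - s)\<^sup>2) * (Re z)\<^sup>2 \<le> 1 * (Re z)\<^sup>2"
        by (intro mult_right_mono) auto
      then show ?thesis using s
        by (intro mult_right_mono divide_right_mono mult_left_mono) auto
    qed
    finally show "norm (?F s) \<le> ?c * (s ^ N * (1 - s) ^ (N - 1))" .
  qed (rule has_integral_integrable[OF exp_error_integral] has_integral_integrable[OF G])+
  then have "cmod (exp_error z) \<le> ?c * (fact N * fact (N - 1) / fact (2 * N))"
    unfolding integral_unique[OF exp_error_integral] integral_unique[OF G] .
  also have "\<dots> = 2 ^ N * fact N / fact (2 * N) * cmod z ^ (2 * N) * exp ((Re z)\<^sup>2)"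
    by simp
  finally show ?thesis .
qed

end

section \<open>Gaussian integrals\<close>

lemma has_bochner_integral_gauss_fourier:
  assumes "\<alpha> > 0"
  shows "has_bochner_integral lborel (\<lambda>x. exp (- (complex_of_real (\<alpha> * x\<^sup>2)) + \<i> * of_real (q * x)))
           (of_real (sqrt (pi / \<alpha>) * exp (- (q\<^sup>2) / (4 * \<alpha>))))"
proof -
  define s where "s = sqrt (2 * \<alpha>)"
  have s: "s > 0" "s\<^sup>2 = 2 * \<alpha>" using assms by (auto simp: s_def)
  let ?f = "\<lambda>x. std_normal_density x *\<^sub>R iexp (q / s * x)"
  have int: "integrable std_normal_distribution (\<lambda>x. iexp (q / s * x))"
    by (intro prob_space.integrable_iexp real_distribution.axioms(1) real_dist_normal_dist) auto
  have 1: "has_bochner_integral lborel ?f (of_real (exp (- ((q / s)\<^sup>2) / 2)))"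
  proof (subst has_bochner_integral_iff, intro conjI)
    show "integrable lborel ?f"
      using int by (subst (asm) integrable_density) (auto simp: normal_density_nonneg)
    have "integral\<^sup>L lborel ?f = integral\<^sup>L std_normal_distribution (\<lambda>x. iexp (q / s * x))"
      by (subst integral_density) (auto simp: normal_density_nonneg)
    also have "\<dots> = of_real (exp (- ((q / s)\<^sup>2) / 2))"
      using fun_cong[OF char_std_normal_distribution, of "q / s"] by (simp add: char_def mult_ac)
    finally show "integral\<^sup>L lborel ?f = of_real (exp (- ((q / s)\<^sup>2) / 2))" .
  qed
  have "has_bochner_integral lborel (\<lambda>x. of_real (sqrt (2 * pi)) * ?f (0 + s * x))
      (of_real (sqrt (2 * pi)) * (of_real (exp (- ((q / s)\<^sup>2) / 2)) /\<^sub>R \<bar>s\<bar>))"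
    using s 1 by (intro has_bochner_integral_mult_right lborel_has_bochner_integral_real_affine_iff[THEN iffD1]) auto
  also have "(\<lambda>x. of_real (sqrt (2 * pi)) * ?f (0 + s * x)) = (\<lambda>x. exp (- (of_real (\<alpha> * x\<^sup>2)) + \<i> * of_real (q * x)))"
    using s by (simp add: fun_eq_iff std_normal_density_def scaleR_conv_of_real exp_of_real[symmetric]
        exp_add[symmetric] power_mult_distrib mult_ac del: exp_of_real)
  also have "of_real (sqrt (2 * pi)) * (of_real (exp (- ((q / s)\<^sup>2) / 2)) /\<^sub>R \<bar>s\<bar>) =
      complex_of_real (sqrt (pi / \<alpha>) * exp (- (q\<^sup>2) / (4 * \<alpha>)))"
    using s assms by (simp add: scaleR_conv_of_real power_divide s_def real_sqrt_mult real_sqrt_divide field_simps)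
  finally show ?thesis .
qed

text \<open>Completing the square only in the real part of \<open>\<beta>\<close> amounts to a real
  translation, which reduces the claim to the Fourier case without a contour shift.\<close>

lemma has_bochner_integral_gauss:
  fixes \<beta> :: complex
  assumes "\<alpha> > 0"
  shows "has_bochner_integral lborel (\<lambda>x. exp (- (of_real (\<alpha> * x\<^sup>2)) + \<beta> * of_real x))
           (of_real (sqrt (pi / \<alpha>)) * exp (\<beta>\<^sup>2 / of_real (4 * \<alpha>)))"
proof -
  define u where "u = Re \<beta> / (2 * \<alpha>)"
  define q where "q = Im \<beta>"
  have \<beta>: "\<beta> = of_real (2 * \<alpha> * u) + \<i> * of_real q"
    using assms by (simp add: u_def q_def complex_eq_iff)
  let ?c = "exp (of_real (\<alpha> * u\<^sup>2) + \<i> * of_real (q * u))"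
  have "has_bochner_integral lborel (\<lambda>x. exp (- (of_real (\<alpha> * (- u + 1 * x)\<^sup>2)) + \<i> * of_real (q * (- u + 1 * x))))
           (of_real (sqrt (pi / \<alpha>) * exp (- (q\<^sup>2) / (4 * \<alpha>))) /\<^sub>R \<bar>1\<bar>)"
    by (intro lborel_has_bochner_integral_real_affine_iff[THEN iffD1] has_bochner_integral_gauss_fourier assms) auto
  then have "has_bochner_integral lborel (\<lambda>x. ?c * exp (- (of_real (\<alpha> * (- u + 1 * x)\<^sup>2)) + \<i> * of_real (q * (- u + 1 * x))))
           (?c * (of_real (sqrt (pi / \<alpha>) * exp (- (q\<^sup>2) / (4 * \<alpha>))) /\<^sub>R \<bar>1\<bar>))"
    by (rule has_bochner_integral_mult_right)
  also have "(\<lambda>x. ?c * exp (- (of_real (\<alpha> * (- u + 1 * x)\<^sup>2)) + \<i> * of_real (q * (- u + 1 * x))))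
      = (\<lambda>x. exp (- (of_real (\<alpha> * x\<^sup>2)) + \<beta> * of_real x))"
    unfolding exp_add[symmetric] \<beta>
    by (intro ext arg_cong[where f = exp]) (simp add: power2_eq_square algebra_simps)
  also have "?c * (of_real (sqrt (pi / \<alpha>) * exp (- (q\<^sup>2) / (4 * \<alpha>))) /\<^sub>R \<bar>1\<bar>)
      = of_real (sqrt (pi / \<alpha>)) * (?c * exp (of_real (- (q\<^sup>2) / (4 * \<alpha>))))"
    by (simp only: exp_of_real of_real_mult abs_one inverse_1 scaleR_one mult_ac)
  also have "?c * exp (of_real (- (q\<^sup>2) / (4 * \<alpha>))) = exp (\<beta>\<^sup>2 / of_real (4 * \<alpha>))"
    unfolding exp_add[symmetric] \<beta> using assms
    by (intro arg_cong[where f = exp]) (simp add: power2_eq_square field_simps complex_eq_iff)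
  finally show ?thesis .
qed

text \<open>The factor (2k)!/(4^k k!) is written as a Pochhammer symbol in view of the Vandermonde
  sum for the planar moment.\<close>

lemma has_bochner_integral_gauss_moment:
  assumes "\<alpha> > 0"
  shows "has_bochner_integral lborel (\<lambda>x. exp (- (\<alpha> * x\<^sup>2)) * x ^ (2 * k))
           (sqrt (pi / \<alpha>) * (pochhammer (1 / 2) k / \<alpha> ^ k))"
proof -
  define s where "s = sqrt (1 / (2 * \<alpha>))"
  have s: "s > 0" "s\<^sup>2 = 1 / (2 * \<alpha>)" using assms by (auto simp: s_def)
  have "has_bochner_integral lborel (\<lambda>x. sqrt (pi / \<alpha>) * (normal_density 0 s x * (x - 0) ^ (2 * k)))
     (sqrt (pi / \<alpha>) * (fact (2 * k) / ((2 / s\<^sup>2)^k * fact k)))"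
    by (intro has_bochner_integral_mult_right normal_moment_even s)
  also have "(\<lambda>x. sqrt (pi / \<alpha>) * (normal_density 0 s x * (x - 0) ^ (2 * k))) = (\<lambda>x. exp (- (\<alpha> * x\<^sup>2)) * x ^ (2 * k))"
    using assms by (simp add: normal_density_def s(2) fun_eq_iff real_sqrt_divide field_simps)
  also have "fact (2 * k) / ((2 / s\<^sup>2)^k * fact k) = pochhammer (1 / 2) k / \<alpha> ^ k"
    unfolding s(2) fact_double using assms by (simp add: power_mult_distrib power_mult)
  finally show ?thesis .
qed

lemma integrable_gauss_power: "\<alpha> > 0 \<Longrightarrow> integrable lborel (\<lambda>x. exp (- (\<alpha> * x\<^sup>2)) * (x\<^sup>2 + v\<^sup>2) ^ n)"
  for \<alpha> :: real
proof -
  assume \<alpha>: "\<alpha> > 0"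
  have "(\<lambda>x. exp (- (\<alpha> * x\<^sup>2)) * (x\<^sup>2 + v\<^sup>2) ^ n)
     = (\<lambda>x. \<Sum>k\<le>n. of_nat (n choose k) * v ^ (2 * (n - k)) * (exp (- (\<alpha> * x\<^sup>2)) * x ^ (2 * k)))"
    unfolding binomial_ring power_mult sum_distrib_left by (simp add: mult_ac)
  then show ?thesis
    using has_bochner_integral_gauss_moment[OF \<alpha>]
    by (auto intro!: Bochner_Integration.integrable_sum integrable_mult_right dest: integrable.intros simp: has_bochner_integral_iff)
qed

text \<open>Instead of polar coordinates: binomial expansion into products of one-dimensional
  moments, summed by Vandermonde's identity for Pochhammer symbols, where 1/2 + 1/2 = 1 produces
  n!.\<close>

lemma has_bochner_integral_gauss_planar_moment:
  assumes "\<alpha> > 0"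
  shows "has_bochner_integral lborel
     (\<lambda>v. exp (- (\<alpha> * v\<^sup>2)) * (LINT x|lborel. exp (- (\<alpha> * x\<^sup>2)) * (x\<^sup>2 + v\<^sup>2) ^ n))
     (pi * fact n / \<alpha> ^ Suc n)"
proof -
  let ?m = "\<lambda>k. sqrt (pi / \<alpha>) * (pochhammer (1 / 2) k / \<alpha> ^ k)"
  have "has_bochner_integral lborel (\<lambda>x. exp (- (\<alpha> * x\<^sup>2)) * (x\<^sup>2 + v\<^sup>2) ^ n)
      (\<Sum>k\<le>n. of_nat (n choose k) * v ^ (2 * (n - k)) * ?m k)" for v
  proof -
    have "(\<lambda>x. exp (- (\<alpha> * x\<^sup>2)) * (x\<^sup>2 + v\<^sup>2) ^ n)
       = (\<lambda>x. \<Sum>k\<le>n. of_nat (n choose k) * v ^ (2 * (n - k)) * (exp (- (\<alpha> * x\<^sup>2)) * x ^ (2 * k)))"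
      unfolding binomial_ring power_mult sum_distrib_left by (simp add: mult_ac)
    then show ?thesis
      by (simp only:) (intro has_bochner_integral_sum has_bochner_integral_mult_right
          has_bochner_integral_gauss_moment assms)
  qed
  then have eq: "(LINT x|lborel. exp (- (\<alpha> * x\<^sup>2)) * (x\<^sup>2 + v\<^sup>2) ^ n) = (\<Sum>k\<le>n. of_nat (n choose k) * v ^ (2 * (n - k)) * ?m k)" for v
    by (rule has_bochner_integral_integral_eq)
  have "has_bochner_integral lborel (\<lambda>v. \<Sum>k\<le>n. of_nat (n choose k) * ?m k * (exp (- (\<alpha> * v\<^sup>2)) * v ^ (2 * (n - k))))
     (\<Sum>k\<le>n. of_nat (n choose k) * ?m k * ?m (n - k))"
    by (intro has_bochner_integral_sum has_bochner_integral_mult_right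
          has_bochner_integral_gauss_moment assms)
  also have "(\<lambda>v. \<Sum>k\<le>n. of_nat (n choose k) * ?m k * (exp (- (\<alpha> * v\<^sup>2)) * v ^ (2 * (n - k)))) =
      (\<lambda>v. exp (- (\<alpha> * v\<^sup>2)) * (LINT x|lborel. exp (- (\<alpha> * x\<^sup>2)) * (x\<^sup>2 + v\<^sup>2) ^ n))"
    unfolding eq by (simp add: fun_eq_iff sum_distrib_left mult_ac)
  also have "(\<Sum>k\<le>n. of_nat (n choose k) * ?m k * ?m (n - k)) =
      (\<Sum>k\<le>n. (pi / \<alpha> ^ Suc n) * (of_nat (n choose k) * pochhammer (1 / 2) k * pochhammer (1 / 2) (n - k)))"
  proof (intro sum.cong refl)
    fix k assume "k \<in> {..n}"
    then have "\<alpha> ^ n = \<alpha> ^ k * \<alpha> ^ (n - k)"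
      by (simp flip: power_add)
    moreover have "sqrt (pi / \<alpha>) * sqrt (pi / \<alpha>) = pi / \<alpha>"
      using assms by simp
    moreover have "of_nat (n choose k) * ?m k * ?m (n - k) = (sqrt (pi / \<alpha>) * sqrt (pi / \<alpha>)) *
        (of_nat (n choose k) * pochhammer (1 / 2) k * pochhammer (1 / 2) (n - k)) / (\<alpha> ^ k * \<alpha> ^ (n - k))"
      by (simp only: times_divide_eq_left times_divide_eq_right divide_divide_eq_left divide_divide_eq_right mult_ac)
    ultimately have "of_nat (n choose k) * ?m k * ?m (n - k) =
        (pi / \<alpha>) * (of_nat (n choose k) * pochhammer (1 / 2) k * pochhammer (1 / 2) (n - k)) / \<alpha> ^ n"
      by (simp only:)
    then show "of_nat (n choose k) * ?m k * ?m (n - k) = (pi / \<alpha> ^ Suc n) * (of_nat (n choose k) * pochhammer (1 / 2) k * pochhammer (1 / 2) (n - k))"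
      by simp
  qed
  also have "\<dots> = pi / \<alpha> ^ Suc n * pochhammer 1 n"
    using pochhammer_binomial_sum[of "1 / 2 :: real" "1 / 2" n] by (simp add: sum_distrib_left)
  finally show ?thesis by (simp add: pochhammer_fact)
qed

lemma integral_Cauchy_Schwarz:
  fixes f g :: "'a \<Rightarrow> real"
  assumes f: "integrable M (\<lambda>x. (f x)\<^sup>2)" and g: "integrable M (\<lambda>x. (g x)\<^sup>2)"
    and fg: "integrable M (\<lambda>x. f x * g x)" and pos: "(LINT x|M. (f x)\<^sup>2) > 0"
  shows "(LINT x|M. f x * g x)\<^sup>2 \<le> (LINT x|M. (f x)\<^sup>2) * (LINT x|M. (g x)\<^sup>2)"
proof -
  let ?A = "LINT x|M. (f x)\<^sup>2" and ?B = "LINT x|M. f x * g x" and ?C = "LINT x|M. (g x)\<^sup>2"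
  have "0 \<le> (LINT x|M. (?B * f x - ?A * g x)\<^sup>2)"
    by (rule Bochner_Integration.integral_nonneg) simp
  also have "\<dots> = (LINT x|M. ?B\<^sup>2 * (f x)\<^sup>2 - 2 * ?A * ?B * (f x * g x) + ?A\<^sup>2 * (g x)\<^sup>2)"
    by (simp add: power2_eq_square algebra_simps)
  also have "\<dots> = ?B\<^sup>2 * ?A - 2 * ?A * ?B * ?B + ?A\<^sup>2 * ?C"
    using f g fg by simp
  also have "\<dots> = ?A * (?A * ?C - ?B\<^sup>2)"
    by (simp add: power2_eq_square algebra_simps)
  finally show ?thesis using pos by (simp add: zero_le_mult_iff)
qed

section \<open>Weighted least squares\<close>

lemma integrable_gauss_mult_bounded:
  fixes h :: "real \<Rightarrow> 'a::{real_normed_algebra_1,banach,second_countable_topology}"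
  assumes "\<alpha> > 0" and cont: "continuous_on UNIV h" and bound: "\<And>x. norm (h x) \<le> B"
  shows "integrable lborel (\<lambda>x. exp (- (\<alpha> * x\<^sup>2)) *\<^sub>R h x)"
proof (rule Bochner_Integration.integrable_bound)
  show "integrable lborel (\<lambda>x. B * (exp (- (\<alpha> * x\<^sup>2)) * x ^ (2 * 0)))"
    using has_bochner_integral_gauss_moment[OF assms(1), of 0]
    by (intro integrable_mult_right) (auto dest: integrable.intros)
  have "continuous_on UNIV (\<lambda>x. exp (- (\<alpha> * x\<^sup>2)) *\<^sub>R h x)"
    by (intro continuous_intros cont)
  then show "(\<lambda>x. exp (- (\<alpha> * x\<^sup>2)) *\<^sub>R h x) \<in> borel_measurable lborel"
    by (simp add: borel_measurable_continuous_onI)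
  have "B \<ge> 0" using bound[of 0] norm_ge_zero order_trans by blast
  then show "AE x in lborel. norm (exp (- (\<alpha> * x\<^sup>2)) *\<^sub>R h x) \<le> norm (B * (exp (- (\<alpha> * x\<^sup>2)) * x ^ (2 * 0)))"
    using bound by (intro AE_I2) (simp add: mult.commute mult_right_mono abs_mult)
qed

text \<open>The hypothesis is the system of normal equations for the weight \<open>e\<^bsup>-6v^2\<^esup>\<close>.\<close>

lemma gauss_least_squares:
  fixes t :: "'i \<Rightarrow> real" and \<gamma> \<delta> :: "'i \<Rightarrow> complex"
  assumes I: "finite I"
    and normal: "\<And>k. k \<in> I \<Longrightarrow> (\<Sum>j\<in>I. of_real (exp (- (3 / 8) * (t j - t k)\<^sup>2)) * \<gamma> j)
        = of_real (sqrt (2 / 3) * exp (- (t k)\<^sup>2 / 4))"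
  defines "g \<equiv> \<lambda>\<gamma> v. of_real (exp (- 3 * v\<^sup>2)) - (\<Sum>j\<in>I. \<gamma> j * iexp (- 3 * t j * v))"
  shows "integrable lborel (\<lambda>v. exp (- (6 * v\<^sup>2)) * (cmod (g \<delta> v))\<^sup>2)" (is ?int)
    and "(LINT v|lborel. exp (- (6 * v\<^sup>2)) * (cmod (g \<gamma> v))\<^sup>2)
       \<le> (LINT v|lborel. exp (- (6 * v\<^sup>2)) * (cmod (g \<delta> v))\<^sup>2)"
proof -
  have cont: "continuous_on UNIV (g \<gamma>)" for \<gamma>
    unfolding g_def by (intro continuous_intros)
  have bound: "cmod (g \<gamma> v) \<le> 1 + (\<Sum>j\<in>I. cmod (\<gamma> j))" for \<gamma> v
    unfolding g_def
    by (rule order_trans[OF norm_triangle_ineq4])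
       (intro add_mono order_trans[OF norm_sum] sum_mono, auto simp: norm_mult)
  have int: "integrable lborel (\<lambda>v. exp (- (6 * v\<^sup>2)) * (cmod (g \<gamma> v))\<^sup>2)" for \<gamma>
  proof -
    have "integrable lborel (\<lambda>v. exp (- (6 * v\<^sup>2)) *\<^sub>R (cmod (g \<gamma> v))\<^sup>2)"
      by (rule integrable_gauss_mult_bounded[where B = "(1 + (\<Sum>j\<in>I. cmod (\<gamma> j)))\<^sup>2"])
        (auto intro!: continuous_intros cont power_mono bound)
    then show ?thesis by simp
  qed
  then show ?int .
  define d where "d v = (\<Sum>j\<in>I. (\<delta> j - \<gamma> j) * iexp (- 3 * t j * v))" for v
  \<comment> \<open>Target times weight has rate 3 + 6 = 9. The Fourier transforms at rates 9 and 6
    give exp(-t_k^2/4) and exp(-(3/8)(t_j - t_k)^2), and their prefactors have ratio sqrt(2/3):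
    orthogonality is the given system.\<close>
  have orth: "has_bochner_integral lborel (\<lambda>v. of_real (exp (- (6 * v\<^sup>2))) * g \<gamma> v * cnj (iexp (- 3 * t k * v))) 0"
    if k: "k \<in> I" for k
  proof -
    have "has_bochner_integral lborel
      (\<lambda>v. exp (- (of_real (9 * v\<^sup>2)) + \<i> * of_real (3 * t k * v))
        - (\<Sum>j\<in>I. \<gamma> j * exp (- (of_real (6 * v\<^sup>2)) + \<i> * of_real (- 3 * (t j - t k) * v))))
      (of_real (sqrt (pi / 9) * exp (- ((3 * t k)\<^sup>2) / (4 * 9)))
        - (\<Sum>j\<in>I. \<gamma> j * of_real (sqrt (pi / 6) * exp (- ((- 3 * (t j - t k))\<^sup>2) / (4 * 6)))))"
      by (intro has_bochner_integral_diff has_bochner_integral_sum has_bochner_integral_mult_right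
          has_bochner_integral_gauss_fourier) auto
    also have "(\<lambda>v. exp (- (of_real (9 * v\<^sup>2)) + \<i> * of_real (3 * t k * v))
        - (\<Sum>j\<in>I. \<gamma> j * exp (- (of_real (6 * v\<^sup>2)) + \<i> * of_real (- 3 * (t j - t k) * v))))
      = (\<lambda>v. of_real (exp (- (6 * v\<^sup>2))) * g \<gamma> v * cnj (iexp (- 3 * t k * v)))"
    proof
      fix v
      have "exp (- (of_real (9 * v\<^sup>2)) + \<i> * of_real (3 * t k * v))
          = of_real (exp (- (6 * v\<^sup>2))) * of_real (exp (- 3 * v\<^sup>2)) * iexp (3 * t k * v)"
        unfolding exp_of_real[symmetric] exp_add[symmetric] by (intro arg_cong[where f = exp]) simp
      moreover have "exp (- (of_real (6 * v\<^sup>2)) + \<i> * of_real (- 3 * (t j - t k) * v))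
          = of_real (exp (- (6 * v\<^sup>2))) * iexp (- 3 * t j * v) * iexp (3 * t k * v)" for j
        unfolding exp_of_real[symmetric] exp_add[symmetric]
        by (intro arg_cong[where f = exp]) (simp add: algebra_simps)
      moreover have "cnj (iexp (- 3 * t k * v)) = iexp (3 * t k * v)"
        by (simp add: exp_cnj)
      ultimately show "exp (- (of_real (9 * v\<^sup>2)) + \<i> * of_real (3 * t k * v))
        - (\<Sum>j\<in>I. \<gamma> j * exp (- (of_real (6 * v\<^sup>2)) + \<i> * of_real (- 3 * (t j - t k) * v)))
        = of_real (exp (- (6 * v\<^sup>2))) * g \<gamma> v * cnj (iexp (- 3 * t k * v))"
        unfolding g_def by (simp only: right_diff_distrib left_diff_distrib sum_distrib_left sum_distrib_right mult_ac)
    qed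
    also have "of_real (sqrt (pi / 9) * exp (- ((3 * t k)\<^sup>2) / (4 * 9)))
        - (\<Sum>j\<in>I. \<gamma> j * of_real (sqrt (pi / 6) * exp (- ((- 3 * (t j - t k))\<^sup>2) / (4 * 6))))
      = of_real (sqrt (pi / 6)) * (of_real (sqrt (2 / 3) * exp (- (t k)\<^sup>2 / 4)) -
         (\<Sum>j\<in>I. of_real (exp (- (3 / 8) * (t j - t k)\<^sup>2)) * \<gamma> j))"
    proof -
      have "sqrt (pi / 9) = sqrt (pi / 6) * sqrt (2 / 3)"
        by (simp flip: real_sqrt_mult)
      moreover have "- ((3 * t k)\<^sup>2) / (4 * 9) = - (t k)\<^sup>2 / 4"
        by (simp add: power_mult_distrib)
      moreover have "- ((- 3 * (t j - t k))\<^sup>2) / (4 * 6) = - (3 / 8) * (t j - t k)\<^sup>2" for j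
        unfolding power_mult_distrib by simp
      ultimately show ?thesis
        by (simp only: of_real_mult right_diff_distrib sum_distrib_left mult_ac)
    qed
    also have "\<dots> = 0" by (simp only: normal[OF k]) simp
    finally show ?thesis .
  qed
  have "has_bochner_integral lborel
     (\<lambda>v. \<Sum>k\<in>I. cnj (\<delta> k - \<gamma> k) * (of_real (exp (- (6 * v\<^sup>2))) * g \<gamma> v * cnj (iexp (- 3 * t k * v))))
     (\<Sum>k\<in>I. cnj (\<delta> k - \<gamma> k) * 0)"
    by (intro has_bochner_integral_sum has_bochner_integral_mult_right orth)
  then have orth_d: "has_bochner_integral lborel (\<lambda>v. of_real (exp (- (6 * v\<^sup>2))) * g \<gamma> v * cnj (d v)) 0"
    unfolding d_def by (simp add: sum_distrib_left mult_ac)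
  define q where "q v = Re (of_real (exp (- (6 * v\<^sup>2))) * g \<gamma> v * cnj (d v))" for v
  have "has_bochner_integral lborel (\<lambda>v. Re (of_real (exp (- (6 * v\<^sup>2))) * g \<gamma> v * cnj (d v))) (Re 0)"
    using orth_d by (rule has_bochner_integral_bounded_linear[OF bounded_linear_Re])
  then have Re0: "has_bochner_integral lborel (\<lambda>v. q v) 0"
    by (simp only: q_def zero_complex.sel)
  \<comment> \<open>The cross term \<open>q\<close> has integral 0, so subtracting it is free and
    makes the comparison pointwise: |g|^2 - 2 Re(g cnj d) \<le> |g - d|^2.\<close>
  have "(LINT v|lborel. exp (- (6 * v\<^sup>2)) * (cmod (g \<gamma> v))\<^sup>2)
      = (LINT v|lborel. exp (- (6 * v\<^sup>2)) * (cmod (g \<gamma> v))\<^sup>2 - 2 * q v)"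
    using Re0 int[of \<gamma>] by (simp add: has_bochner_integral_iff)
  also have "\<dots> \<le> (LINT v|lborel. exp (- (6 * v\<^sup>2)) * (cmod (g \<delta> v))\<^sup>2)"
  proof (rule integral_mono)
    show "integrable lborel (\<lambda>v. exp (- (6 * v\<^sup>2)) * (cmod (g \<gamma> v))\<^sup>2 - 2 * q v)"
      using Re0 int[of \<gamma>] by (auto simp: has_bochner_integral_iff)
    fix v
    have "g \<delta> v = g \<gamma> v - d v"
      unfolding g_def d_def by (simp add: left_diff_distrib sum_subtractf)
    then have "(cmod (g \<delta> v))\<^sup>2 = (cmod (g \<gamma> v))\<^sup>2 - 2 * Re (g \<gamma> v * cnj (d v)) + (cmod (d v))\<^sup>2"
      by (simp only: cmod_power2) (simp add: power2_eq_square algebra_simps)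
    then have "(cmod (g \<gamma> v))\<^sup>2 - 2 * Re (g \<gamma> v * cnj (d v)) \<le> (cmod (g \<delta> v))\<^sup>2"
      by simp
    then have "exp (- (6 * v\<^sup>2)) * ((cmod (g \<gamma> v))\<^sup>2 - 2 * Re (g \<gamma> v * cnj (d v))) \<le> exp (- (6 * v\<^sup>2)) * (cmod (g \<delta> v))\<^sup>2"
      by (intro mult_left_mono) auto
    then show "exp (- (6 * v\<^sup>2)) * (cmod (g \<gamma> v))\<^sup>2 - 2 * q v
        \<le> exp (- (6 * v\<^sup>2)) * (cmod (g \<delta> v))\<^sup>2"
      unfolding q_def by (simp add: algebra_simps)
  qed (rule int)
  finally show "(LINT v|lborel. exp (- (6 * v\<^sup>2)) * (cmod (g \<gamma> v))\<^sup>2)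
       \<le> (LINT v|lborel. exp (- (6 * v\<^sup>2)) * (cmod (g \<delta> v))\<^sup>2)" .
qed

section \<open>Discretising the Gaussian\<close>

text \<open>The kernel is exp(-(2z + 3iv)^2) on the line z = p - iv, where 2z + 3iv = 2p + iv. Its
  centre z = -3iv/2 turns e^(2tz) into the frequency -3t.\<close>

lemma has_bochner_integral_shifted_gauss_exp:
  fixes t v :: real
  shows "has_bochner_integral lborel
     (\<lambda>p. exp (- ((of_real (2 * p) + \<i> * of_real v)\<^sup>2)) * exp (2 * of_real t * (of_real p - \<i> * of_real v)))
     (of_real (sqrt pi / 2 * exp (t\<^sup>2 / 4)) * iexp (- 3 * t * v))"
proof -
  let ?\<beta> = "of_real (2 * t) - \<i> * of_real (4 * v)" and ?c = "exp (of_real (v\<^sup>2) - \<i> * of_real (2 * t * v))"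
  have "has_bochner_integral lborel (\<lambda>p. ?c * exp (- (of_real (4 * p\<^sup>2)) + ?\<beta> * of_real p))
      (?c * (of_real (sqrt (pi / 4)) * exp (?\<beta>\<^sup>2 / of_real (4 * 4))))"
    by (intro has_bochner_integral_mult_right has_bochner_integral_gauss) auto
  also have "(\<lambda>p. ?c * exp (- (of_real (4 * p\<^sup>2)) + ?\<beta> * of_real p)) =
     (\<lambda>p. exp (- ((of_real (2 * p) + \<i> * of_real v)\<^sup>2)) * exp (2 * of_real t * (of_real p - \<i> * of_real v)))"
    unfolding exp_add[symmetric]
    by (intro ext arg_cong[where f = exp]) (simp add: complex_eq_iff power2_eq_square algebra_simps)
  also have "?c * (of_real (sqrt (pi / 4)) * exp (?\<beta>\<^sup>2 / of_real (4 * 4))) =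
      of_real (sqrt (pi / 4)) * (?c * exp (?\<beta>\<^sup>2 / of_real (4 * 4)))"
    by simp
  also have "?c * exp (?\<beta>\<^sup>2 / of_real (4 * 4)) = of_real (exp (t\<^sup>2 / 4)) * iexp (- 3 * t * v)"
    unfolding exp_add[symmetric] exp_of_real[symmetric]
    by (intro arg_cong[where f = exp]) (simp add: complex_eq_iff power2_eq_square field_simps)
  also have "sqrt (pi / 4) = sqrt pi / 2"
    by (simp add: real_sqrt_divide)
  finally show ?thesis by (simp only: of_real_mult mult.assoc)
qed

lemma has_bochner_integral_shifted_gauss_gauss:
  fixes v :: real
  shows "has_bochner_integral lborel
     (\<lambda>p. exp (- ((of_real (2 * p) + \<i> * of_real v)\<^sup>2)) * exp ((of_real p - \<i> * of_real v)\<^sup>2))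
     (of_real (sqrt (pi / 3) * exp (- 3 * v\<^sup>2)))"
proof -
  have "has_bochner_integral lborel (\<lambda>p. exp (- (of_real (3 * p\<^sup>2)) + \<i> * of_real (- 6 * v * p)))
      (of_real (sqrt (pi / 3) * exp (- ((- 6 * v)\<^sup>2) / (4 * 3))))"
    by (intro has_bochner_integral_gauss_fourier) auto
  also have "(\<lambda>p. exp (- (of_real (3 * p\<^sup>2)) + \<i> * of_real (- 6 * v * p))) =
     (\<lambda>p. exp (- ((of_real (2 * p) + \<i> * of_real v)\<^sup>2)) * exp ((of_real p - \<i> * of_real v)\<^sup>2))"
    unfolding exp_add[symmetric]
    by (intro ext arg_cong[where f = exp]) (simp add: complex_eq_iff power2_eq_square algebra_simps)
  also have "- ((- 6 * v)\<^sup>2) / (4 * 3) = - 3 * v\<^sup>2" by (simp add: power2_eq_square)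
  finally show ?thesis .
qed

context hermite_nodes begin

text \<open>The error of the competitor in the least squares problem. The factor sqrt(3)/2 is
  sqrt(3/pi), which normalises the kernel average of e^(z^2) to e^(-3v^2), times the sqrt(pi)/2 from
  averaging an exponential.\<close>

definition residual :: "real \<Rightarrow> complex" where
  "residual v = of_real (exp (- 3 * v\<^sup>2))
     - (\<Sum>a\<in>S. of_real (sqrt 3 / 2 * weight a * exp (a\<^sup>2 / 4)) * iexp (- 3 * a * v))"

lemma residual_eq_integral:
  "has_bochner_integral lborel
     (\<lambda>p. of_real (sqrt (3 / pi)) * (exp (- ((of_real (2 * p) + \<i> * of_real v)\<^sup>2)) * exp_error (of_real p - \<i> * of_real v)))
     (residual v)"
proof -
  let ?g = "\<lambda>p. exp (- ((of_real (2 * p) + \<i> * of_real v)\<^sup>2)) :: complex"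
  have "has_bochner_integral lborel (\<lambda>p. of_real (sqrt (3 / pi)) * (?g p * exp ((of_real p - \<i> * of_real v)\<^sup>2)
      - (\<Sum>a\<in>S. of_real (weight a) * (?g p * exp (2 * of_real a * (of_real p - \<i> * of_real v))))))
    (of_real (sqrt (3 / pi)) * (of_real (sqrt (pi / 3) * exp (- 3 * v\<^sup>2)) -
      (\<Sum>a\<in>S. of_real (weight a) * (of_real (sqrt pi / 2 * exp (a\<^sup>2 / 4)) * iexp (- 3 * a * v)))))"
    by (intro has_bochner_integral_mult_right has_bochner_integral_diff has_bochner_integral_sum
        has_bochner_integral_shifted_gauss_exp has_bochner_integral_shifted_gauss_gauss)
  also have "(\<lambda>p. of_real (sqrt (3 / pi)) * (?g p * exp ((of_real p - \<i> * of_real v)\<^sup>2)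
      - (\<Sum>a\<in>S. of_real (weight a) * (?g p * exp (2 * of_real a * (of_real p - \<i> * of_real v))))))
    = (\<lambda>p. of_real (sqrt (3 / pi)) * (?g p * exp_error (of_real p - \<i> * of_real v)))"
    unfolding exp_error_def quad_def scaleR_conv_of_real
    by (simp only: right_diff_distrib sum_distrib_left mult.left_commute)
  also have "of_real (sqrt (3 / pi)) * (of_real (sqrt (pi / 3) * exp (- 3 * v\<^sup>2)) -
      (\<Sum>a\<in>S. of_real (weight a) * (of_real (sqrt pi / 2 * exp (a\<^sup>2 / 4)) * iexp (- 3 * a * v)))) = residual v"
  proof -
    have "sqrt (3 / pi) * (sqrt (pi / 3) * exp (- 3 * v\<^sup>2)) = exp (- 3 * v\<^sup>2)"
      by (simp add: real_sqrt_divide)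
    then have "of_real (sqrt (3 / pi)) * of_real (sqrt (pi / 3) * exp (- 3 * v\<^sup>2)) = complex_of_real (exp (- 3 * v\<^sup>2))"
      by (simp only: flip: of_real_mult)
    moreover have "of_real (sqrt (3 / pi)) * (of_real (weight a) * (of_real (sqrt pi / 2 * exp (a\<^sup>2 / 4)) * iexp (- 3 * a * v)))
       = of_real (sqrt 3 / 2 * weight a * exp (a\<^sup>2 / 4)) * iexp (- 3 * a * v)" for a
    proof -
      have "sqrt (3 / pi) * (weight a * (sqrt pi / 2 * exp (a\<^sup>2 / 4))) = sqrt 3 / 2 * weight a * exp (a\<^sup>2 / 4)"
        by (simp add: real_sqrt_divide)
      then have "of_real (sqrt (3 / pi)) * (of_real (weight a) * of_real (sqrt pi / 2 * exp (a\<^sup>2 / 4)))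
          = complex_of_real (sqrt 3 / 2 * weight a * exp (a\<^sup>2 / 4))"
        by (simp only: flip: of_real_mult)
      then show ?thesis by (simp only: flip: mult.assoc)
    qed
    ultimately show ?thesis
      unfolding residual_def by (simp only: right_diff_distrib sum_distrib_left)
  qed
  finally show ?thesis .
qed

lemma residual_bound:
  fixes v :: real
  defines "c \<equiv> 2 ^ N * fact N / fact (2 * N)"
  shows "(cmod (residual v))\<^sup>2 \<le> 3 / pi * sqrt (pi / 2) * c\<^sup>2 * exp (2 * v\<^sup>2)
    * (LINT p|lborel. exp (- (4 * p\<^sup>2)) * (p\<^sup>2 + v\<^sup>2) ^ (2 * N))"
proof -
  let ?h = "\<lambda>p. of_real (sqrt (3 / pi)) * (exp (- ((of_real (2 * p) + \<i> * of_real v)\<^sup>2)) * exp_error (of_real p - \<i> * of_real v))"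
  let ?I = "LINT p|lborel. exp (- (3 * p\<^sup>2)) * (p\<^sup>2 + v\<^sup>2) ^ N"
  have c: "c \<ge> 0" by (simp add: c_def)
  have "cmod (residual v) = norm (integral\<^sup>L lborel ?h)"
    using residual_eq_integral[of v] by (simp only: has_bochner_integral_integral_eq)
  also have "\<dots> \<le> (LINT p|lborel. norm (?h p))"
    by (rule integral_norm_bound)
  also have "\<dots> \<le> (LINT p|lborel. sqrt (3 / pi) * c * exp (v\<^sup>2) * (exp (- (3 * p\<^sup>2)) * (p\<^sup>2 + v\<^sup>2) ^ N))"
  proof (rule integral_mono)
    show "integrable lborel (\<lambda>p. norm (?h p))"
      using residual_eq_integral[of v] by (intro integrable_norm) (simp only: has_bochner_integral_iff)
    show "integrable lborel (\<lambda>p. sqrt (3 / pi) * c * exp (v\<^sup>2) * (exp (- (3 * p\<^sup>2)) * (p\<^sup>2 + v\<^sup>2) ^ N))"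
      by (intro integrable_mult_right integrable_gauss_power) auto
    fix p
    have "cmod (of_real p - \<i> * of_real v) ^ (2 * N) = (p\<^sup>2 + v\<^sup>2) ^ N"
      by (simp add: power_mult cmod_power2)
    then have E: "cmod (exp_error (of_real p - \<i> * of_real v)) \<le> c * (p\<^sup>2 + v\<^sup>2) ^ N * exp (p\<^sup>2)"
      using cmod_exp_error_le[of "of_real p - \<i> * of_real v"] by (simp add: c_def)
    have "norm (?h p) = sqrt (3 / pi) * (exp (v\<^sup>2 - 4 * p\<^sup>2) * cmod (exp_error (of_real p - \<i> * of_real v)))"
      by (simp add: norm_mult power2_eq_square)
    also have "\<dots> \<le> sqrt (3 / pi) * (exp (v\<^sup>2 - 4 * p\<^sup>2) * (c * (p\<^sup>2 + v\<^sup>2) ^ N * exp (p\<^sup>2)))"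
      by (intro mult_left_mono E) auto
    also have "\<dots> = sqrt (3 / pi) * c * (exp (v\<^sup>2 - 4 * p\<^sup>2) * exp (p\<^sup>2)) * (p\<^sup>2 + v\<^sup>2) ^ N"
      by simp
    also have "exp (v\<^sup>2 - 4 * p\<^sup>2) * exp (p\<^sup>2) = exp (v\<^sup>2) * exp (- (3 * p\<^sup>2))"
      by (simp flip: exp_add)
    finally show "norm (?h p) \<le> sqrt (3 / pi) * c * exp (v\<^sup>2) * (exp (- (3 * p\<^sup>2)) * (p\<^sup>2 + v\<^sup>2) ^ N)"
      by (simp add: mult_ac)
  qed
  also have "\<dots> = sqrt (3 / pi) * c * exp (v\<^sup>2) * ?I"
    by simp
  finally have "(cmod (residual v))\<^sup>2 \<le> (sqrt (3 / pi) * c * exp (v\<^sup>2) * ?I)\<^sup>2"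
    by (intro power_mono) auto
  also have "\<dots> = 3 / pi * c\<^sup>2 * exp (2 * v\<^sup>2) * ?I\<^sup>2"
    by (simp add: power_mult_distrib exp_double)
  also have "\<dots> \<le> 3 / pi * c\<^sup>2 * exp (2 * v\<^sup>2) * (sqrt (pi / 2) * (LINT p|lborel. exp (- (4 * p\<^sup>2)) * (p\<^sup>2 + v\<^sup>2) ^ (2 * N)))"
  proof -
    \<comment> \<open>The split e^(-3p^2) = e^(-p^2) e^(-2p^2) leaves e^(-4p^2) after squaring,
      matching the rate that the weight will leave in v.\<close>
    let ?f = "\<lambda>p::real. exp (- (p\<^sup>2))" and ?g = "\<lambda>p::real. exp (- (2 * p\<^sup>2)) * (p\<^sup>2 + v\<^sup>2) ^ N"
    have f2: "(?f p)\<^sup>2 = exp (- (2 * p\<^sup>2)) * p ^ (2 * 0)" for p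
      by (simp add: power2_eq_square flip: exp_add)
    have g2: "(?g p)\<^sup>2 = exp (- (4 * p\<^sup>2)) * (p\<^sup>2 + v\<^sup>2) ^ (2 * N)" for p
    proof -
      have "(exp (- (2 * p\<^sup>2)))\<^sup>2 = exp (- (4 * p\<^sup>2))"
        by (simp add: power2_eq_square flip: exp_add)
      then show ?thesis by (simp only: power_mult_distrib power_mult[symmetric] mult.commute[of N 2])
    qed
    have fg: "?f p * ?g p = exp (- (3 * p\<^sup>2)) * (p\<^sup>2 + v\<^sup>2) ^ N" for p
      by (simp flip: exp_add mult.assoc)
    have m: "has_bochner_integral lborel (\<lambda>p. (?f p)\<^sup>2) (sqrt (pi / 2))"
      unfolding f2 using has_bochner_integral_gauss_moment[of 2 0] by simp
    have "(LINT p|lborel. ?f p * ?g p)\<^sup>2 \<le> (LINT p|lborel. (?f p)\<^sup>2) * (LINT p|lborel. (?g p)\<^sup>2)"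
    proof (rule integral_Cauchy_Schwarz)
      show "integrable lborel (\<lambda>p. (?f p)\<^sup>2)" using m by (rule integrable.intros)
      show "integrable lborel (\<lambda>p. (?g p)\<^sup>2)" unfolding g2 by (rule integrable_gauss_power) simp
      show "integrable lborel (\<lambda>p. ?f p * ?g p)" unfolding fg by (rule integrable_gauss_power) simp
      show "(LINT p|lborel. (?f p)\<^sup>2) > 0" unfolding has_bochner_integral_integral_eq[OF m] by simp
    qed
    then show ?thesis
      unfolding fg g2 has_bochner_integral_integral_eq[OF m] by (intro mult_left_mono) auto
  qed
  finally show ?thesis by (simp only: mult_ac)
qed

lemma residual_weighted_norm_le:
  assumes "integrable lborel (\<lambda>v. exp (- (6 * v\<^sup>2)) * (cmod (residual v))\<^sup>2)"
  shows "(LINT v|lborel. exp (- (6 * v\<^sup>2)) * (cmod (residual v))\<^sup>2) \<le> 3 * sqrt (pi / 2) / 2 * real N / 16 ^ N"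
proof -
  define c :: real where "c = 2 ^ N * fact N / fact (2 * N)"
  let ?M = "\<lambda>v. exp (- (4 * v\<^sup>2)) * (LINT p|lborel. exp (- (4 * p\<^sup>2)) * (p\<^sup>2 + v\<^sup>2) ^ (2 * N))"
  have M: "has_bochner_integral lborel ?M (pi * fact (2 * N) / 4 ^ Suc (2 * N))"
    by (rule has_bochner_integral_gauss_planar_moment) simp
  have "(LINT v|lborel. exp (- (6 * v\<^sup>2)) * (cmod (residual v))\<^sup>2)
      \<le> (LINT v|lborel. 3 / pi * sqrt (pi / 2) * c\<^sup>2 * ?M v)"
  proof (rule integral_mono[OF assms])
    show "integrable lborel (\<lambda>v. 3 / pi * sqrt (pi / 2) * c\<^sup>2 * ?M v)"
      using M by (intro integrable_mult_right) (rule integrable.intros)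
    fix v
    have "exp (- (6 * v\<^sup>2)) * (cmod (residual v))\<^sup>2 \<le> exp (- (6 * v\<^sup>2)) * (3 / pi * sqrt (pi / 2) * c\<^sup>2 * exp (2 * v\<^sup>2)
        * (LINT p|lborel. exp (- (4 * p\<^sup>2)) * (p\<^sup>2 + v\<^sup>2) ^ (2 * N)))"
      unfolding c_def by (intro mult_left_mono residual_bound) auto
    also have "\<dots> = 3 / pi * sqrt (pi / 2) * c\<^sup>2 * ((exp (- (6 * v\<^sup>2)) * exp (2 * v\<^sup>2))
        * (LINT p|lborel. exp (- (4 * p\<^sup>2)) * (p\<^sup>2 + v\<^sup>2) ^ (2 * N)))"
      by (simp only: mult_ac)
    also have "exp (- (6 * v\<^sup>2)) * exp (2 * v\<^sup>2) = exp (- (4 * v\<^sup>2))"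
      by (simp flip: exp_add)
    finally show "exp (- (6 * v\<^sup>2)) * (cmod (residual v))\<^sup>2 \<le> 3 / pi * sqrt (pi / 2) * c\<^sup>2 * ?M v" .
  qed
  also have "\<dots> = 3 / pi * sqrt (pi / 2) * c\<^sup>2 * (pi * fact (2 * N) / 4 ^ Suc (2 * N))"
    using M by (simp add: has_bochner_integral_iff)
  also have "\<dots> = 3 * sqrt (pi / 2) / 4 * (c\<^sup>2 * fact (2 * N)) / 16 ^ N"
    by (simp add: power_mult)
  also have "c\<^sup>2 * fact (2 * N) = 4 ^ N / real ((2 * N) choose N)"
  proof -
    have "real ((2 * N) choose N) = fact (2 * N) / (fact N * fact N)"
      by (simp add: binomial_fact)
    moreover have "(2 ^ N)\<^sup>2 = (4 :: real) ^ N"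
      by (simp add: power_even_eq power2_eq_square flip: power_mult_distrib)
    ultimately show ?thesis
      unfolding c_def by (simp add: power_mult_distrib power_divide) (simp add: power2_eq_square)
  qed
  \<comment> \<open>The linear factor N comes from 4^N / binomial(2N, N) \<le> 2N, a quotient whose
    true order is sqrt(N).\<close>
  also have "3 * sqrt (pi / 2) / 4 * (4 ^ N / real ((2 * N) choose N)) / 16 ^ N \<le> 3 * sqrt (pi / 2) / 4 * (2 * real N) / 16 ^ N"
    using central_binomial_lower_bound[of N] N_pos
    by (intro divide_right_mono mult_left_mono) (auto simp: field_simps)
  finally show ?thesis by (simp add: mult_ac)
qed

end

section \<open>The unweighted norm\<close>

text \<open>Here v^2 \<ge> \<tau>^2 + (|v| - \<tau>)^2. Taking both translates in place of |v| gives
  a majorant with a known integral over the whole line.\<close>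

lemma gauss_tail_le:
  fixes v \<tau> :: real
  assumes "\<tau> \<ge> 0" "\<tau> \<le> \<bar>v\<bar>"
  shows "exp (- (6 * v\<^sup>2)) \<le> exp (- (6 * \<tau>\<^sup>2)) * (exp (- (6 * (v - \<tau>)\<^sup>2)) + exp (- (6 * (v + \<tau>)\<^sup>2)))"
proof -
  have "0 \<le> \<tau> * (\<bar>v\<bar> - \<tau>)" using assms by simp
  then have "\<tau>\<^sup>2 + (\<bar>v\<bar> - \<tau>)\<^sup>2 \<le> v\<^sup>2"
    by (simp add: power2_eq_square algebra_simps)
  then have "exp (- (6 * v\<^sup>2)) \<le> exp (- (6 * \<tau>\<^sup>2)) * exp (- (6 * (\<bar>v\<bar> - \<tau>)\<^sup>2))"
    by (simp flip: exp_add)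
  also have "\<dots> \<le> exp (- (6 * \<tau>\<^sup>2)) * (exp (- (6 * (v - \<tau>)\<^sup>2)) + exp (- (6 * (v + \<tau>)\<^sup>2)))"
  proof (intro mult_left_mono)
    have "(\<bar>v\<bar> - \<tau>)\<^sup>2 = (v - \<tau>)\<^sup>2 \<or> (\<bar>v\<bar> - \<tau>)\<^sup>2 = (v + \<tau>)\<^sup>2"
      by (cases "v \<ge> 0") (simp_all add: power2_eq_square algebra_simps)
    then show "exp (- (6 * (\<bar>v\<bar> - \<tau>)\<^sup>2)) \<le> exp (- (6 * (v - \<tau>)\<^sup>2)) + exp (- (6 * (v + \<tau>)\<^sup>2))"
      by (elim disjE) simp_all
  qed simp
  finally show ?thesis .
qed

lemma has_bochner_integral_gauss_translate:
  fixes \<tau> :: real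
  shows "has_bochner_integral lborel (\<lambda>v. exp (- (6 * (v + \<tau>)\<^sup>2))) (sqrt (pi / 6))"
proof -
  have "has_bochner_integral lborel (\<lambda>v. exp (- (6 * (\<tau> + 1 * v)\<^sup>2)) * (\<tau> + 1 * v) ^ (2 * 0))
      ((sqrt (pi / 6) * (pochhammer (1 / 2) 0 / 6 ^ 0)) /\<^sub>R \<bar>1\<bar>)"
    by (intro lborel_has_bochner_integral_real_affine_iff[THEN iffD1] has_bochner_integral_gauss_moment) auto
  then show ?thesis by (simp add: add.commute)
qed

text \<open>The substitution \<open>x = \<surd>(6\<sigma>) v\<close> turns the weight \<open>e\<^bsup>-x^2/\<sigma>\<^esup>\<close> into \<open>e\<^bsup>-6v^2\<^esup>\<close> and \<open>\<lambda>\<^sub>j x\<close> into \<open>-3\<i>t\<^sub>jv\<close>.\<close>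

theorem theorem3p5:
  fixes \<sigma> \<rho> :: real
  assumes "\<sigma> > 0" and "\<rho> = \<sigma> / 2"
  shows "\<exists>c>0. \<forall>N>1. \<forall>(t :: nat \<Rightarrow> real) (lam :: nat \<Rightarrow> complex) (\<gamma> :: nat \<Rightarrow> complex) (T :: real).
    (\<forall>i\<in>{1..N}. \<forall>j\<in>{1..N}. i < j \<longrightarrow> t i > t j) \<longrightarrow>
    t ` {1..N} = {x. hermite N x = 0} \<longrightarrow>
    (\<forall>j\<in>{1..N}. lam j =
       - \<i> * of_real (sqrt (2 * (\<rho> + \<sigma>) / (\<sigma> * (2 * \<rho> + \<sigma>)))) * of_real (t j)) \<longrightarrow>
    (\<forall>k\<in>{1..N}. (\<Sum>j=1..N. exp ((lam j - lam k)\<^sup>2 * of_real \<rho> / 2) * \<gamma> j) =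
       of_real (sqrt (\<sigma> / (\<sigma> + \<rho>))) *
       exp (of_real (\<sigma> * \<rho>) * (lam k)\<^sup>2 / of_real (2 * (\<sigma> + \<rho>)))) \<longrightarrow>
    T = sqrt (2 * \<sigma> * real N * ln 2) \<longrightarrow>
    (l2_norm (\<lambda>x. of_real (exp (- x\<^sup>2 / (2 * \<sigma>)))
        - indicator {-T..T} x * (\<Sum>k=1..N. \<gamma> k * exp (lam k * of_real x))))\<^sup>2
      \<le> c * 2 powr (- 2 * real N) * real N powr (3 / 2)"
proof (intro exI[of _ "sqrt (6 * \<sigma>) * (3 * sqrt (pi / 2) / 2 + 2 * sqrt (pi / 6))"] conjI allI impI)
  \<comment> \<open>The factor sqrt(6 \<sigma>) is the Jacobian of the substitution; the summands
    come from the weighted error and from the two Gaussian tails.\<close>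
  show "sqrt (6 * \<sigma>) * (3 * sqrt (pi / 2) / 2 + 2 * sqrt (pi / 6)) > 0"
    using assms by (intro mult_pos_pos add_pos_pos) auto
next
  fix N :: nat and t :: "nat \<Rightarrow> real" and lam \<gamma> :: "nat \<Rightarrow> complex" and T :: real
  assume N: "1 < N"
    and decr: "\<forall>i\<in>{1..N}. \<forall>j\<in>{1..N}. i < j \<longrightarrow> t i > t j"
    and zeros: "t ` {1..N} = {x. hermite N x = 0}"
    and lam: "\<forall>j\<in>{1..N}. lam j =
       - \<i> * of_real (sqrt (2 * (\<rho> + \<sigma>) / (\<sigma> * (2 * \<rho> + \<sigma>)))) * of_real (t j)"
    and system: "\<forall>k\<in>{1..N}. (\<Sum>j=1..N. exp ((lam j - lam k)\<^sup>2 * of_real \<rho> / 2) * \<gamma> j) =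
       of_real (sqrt (\<sigma> / (\<sigma> + \<rho>))) *
       exp (of_real (\<sigma> * \<rho>) * (lam k)\<^sup>2 / of_real (2 * (\<sigma> + \<rho>)))"
    and T: "T = sqrt (2 * \<sigma> * real N * ln 2)"
  note \<sigma> = assms(1)
  define s where "s = sqrt (6 * \<sigma>)"
  define \<tau> where "\<tau> = T / s"
  have s: "s > 0" "s\<^sup>2 = 6 * \<sigma>" using \<sigma> by (auto simp: s_def)
  have \<tau>: "\<tau> \<ge> 0" using s T \<sigma> by (simp add: \<tau>_def)
  have \<tau>2: "6 * \<tau>\<^sup>2 = 2 * real N * ln 2"
    using \<sigma> by (simp add: \<tau>_def power_divide s T)
  \<comment> \<open>This is exp(T^2/\<sigma>), the reciprocal of the weight at the ends of the
    interval.\<close>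
  have exp\<tau>: "exp (6 * \<tau>\<^sup>2) = 4 ^ N"
  proof -
    have "exp (6 * \<tau>\<^sup>2) = exp (ln 2) ^ (2 * N)"
      unfolding \<tau>2 exp_of_nat_mult[symmetric] by simp
    then show ?thesis by (simp add: power_mult)
  qed
  have inj: "inj_on t {1..N}"
    by (intro linorder_inj_onI) (use decr in force)+
  interpret hermite_nodes N "t ` {1..N}"
  proof
    show "hermite N a = 0" if "a \<in> t ` {1..N}" for a using that zeros by simp
  qed (use N inj in \<open>auto simp: card_image\<close>)
  \<comment> \<open>\<open>r\<close> is the factor in \<open>lam j = - \<i> * r * t j\<close>; since
    \<open>r * s = 3\<close>, the parameter \<open>\<sigma>\<close> drops out of the
    frequencies.\<close>
  define r where "r = sqrt (3 / (2 * \<sigma>))"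
  have r: "r\<^sup>2 = 3 / (2 * \<sigma>)" "r * s = 3"
  proof -
    show "r\<^sup>2 = 3 / (2 * \<sigma>)" using \<sigma> by (simp add: r_def)
    have "r * s = sqrt (3 / (2 * \<sigma>) * (6 * \<sigma>))"
      unfolding r_def s_def by (rule real_sqrt_mult[symmetric])
    also have "3 / (2 * \<sigma>) * (6 * \<sigma>) = 3\<^sup>2" using \<sigma> by simp
    finally show "r * s = 3" by simp
  qed
  have "2 * (\<rho> + \<sigma>) / (\<sigma> * (2 * \<rho> + \<sigma>)) = 3 / (2 * \<sigma>)"
    unfolding assms(2) using \<sigma> by (simp add: field_simps)
  then have lam': "lam j = - \<i> * of_real (r * t j)" if "j \<in> {1..N}" for j
    using lam that by (simp add: r_def)
  have lam_s: "lam j * of_real (s * v) = \<i> * of_real (- 3 * t j * v)" if "j \<in> {1..N}" for j v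
  proof -
    have "lam j * of_real (s * v) = \<i> * of_real (- (r * s) * t j * v)"
      unfolding lam'[OF that] by simp
    then show ?thesis by (simp add: r)
  qed
  have normal: "(\<Sum>j\<in>{1..N}. of_real (exp (- (3 / 8) * (t j - t k)\<^sup>2)) * \<gamma> j)
        = of_real (sqrt (2 / 3) * exp (- (t k)\<^sup>2 / 4))" if k: "k \<in> {1..N}" for k
  proof -
    have "exp ((lam j - lam k)\<^sup>2 * of_real \<rho> / 2) = of_real (exp (- (3 / 8) * (t j - t k)\<^sup>2))" if j: "j \<in> {1..N}" for j
    proof -
      have "lam j - lam k = - \<i> * of_real (r * (t j - t k))"
        unfolding lam'[OF j] lam'[OF k] by (simp add: algebra_simps)
      then have "(lam j - lam k)\<^sup>2 * of_real \<rho> / 2 = of_real (- (r\<^sup>2 * (t j - t k)\<^sup>2 * \<rho> / 2))"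
        by (simp add: power_mult_distrib)
      also have "r\<^sup>2 * (t j - t k)\<^sup>2 * \<rho> / 2 = 3 / 8 * (t j - t k)\<^sup>2"
        unfolding r assms(2) using \<sigma> by simp
      finally show ?thesis by (simp add: exp_of_real[symmetric] del: exp_of_real)
    qed
    then have "(\<Sum>j\<in>{1..N}. of_real (exp (- (3 / 8) * (t j - t k)\<^sup>2)) * \<gamma> j)
        = (\<Sum>j=1..N. exp ((lam j - lam k)\<^sup>2 * of_real \<rho> / 2) * \<gamma> j)"
      by (intro sum.cong refl) (simp only:)
    also have "\<dots> = of_real (sqrt (\<sigma> / (\<sigma> + \<rho>))) * exp (of_real (\<sigma> * \<rho>) * (lam k)\<^sup>2 / of_real (2 * (\<sigma> + \<rho>)))"
      by (rule system[rule_format, OF k])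
    also have "\<sigma> / (\<sigma> + \<rho>) = 2 / 3"
      unfolding assms(2) using \<sigma> by (simp add: field_simps)
    also have "of_real (\<sigma> * \<rho>) * (lam k)\<^sup>2 / of_real (2 * (\<sigma> + \<rho>)) = complex_of_real (- (\<sigma> * \<rho> * (r\<^sup>2 * (t k)\<^sup>2) / (2 * (\<sigma> + \<rho>))))"
      unfolding lam'[OF k] by (simp add: power_mult_distrib)
    also have "- (\<sigma> * \<rho> * (r\<^sup>2 * (t k)\<^sup>2) / (2 * (\<sigma> + \<rho>))) = - (t k)\<^sup>2 / 4"
      unfolding r assms(2) using \<sigma> by (simp add: field_simps)
    finally show ?thesis by (simp only: exp_of_real of_real_mult)
  qed
  define \<delta> :: "nat \<Rightarrow> complex" where "\<delta> j = of_real (sqrt 3 / 2 * weight (t j) * exp ((t j)\<^sup>2 / 4))" for j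
  let ?g = "\<lambda>\<gamma> v. of_real (exp (- 3 * v\<^sup>2)) - (\<Sum>j\<in>{1..N}. \<gamma> j * iexp (- 3 * t j * v))"
  have res: "?g \<delta> v = residual v" for v
    unfolding residual_def \<delta>_def by (subst sum.reindex[OF inj]) simp
  note lsq = gauss_least_squares[where t = t and \<gamma> = \<gamma> and \<delta> = \<delta>, OF finite_atLeastAtMost normal]
  let ?J = "LINT v|lborel. exp (- (6 * v\<^sup>2)) * (cmod (?g \<gamma> v))\<^sup>2"
  have J: "?J \<le> 3 * sqrt (pi / 2) / 2 * real N / 16 ^ N"
    using lsq residual_weighted_norm_le unfolding res by (blast intro: order_trans)
  \<comment> \<open>Integrability is asserted there for the comparison coefficients, so these are
    taken to be \<open>\<gamma>\<close> itself.\<close>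
  have intJ: "integrable lborel (\<lambda>v. exp (- (6 * v\<^sup>2)) * (cmod (?g \<gamma> v))\<^sup>2)"
    using gauss_least_squares(1)[where t = t and \<gamma> = \<gamma> and \<delta> = \<gamma>, OF finite_atLeastAtMost normal] .
  define F where "F x = of_real (exp (- x\<^sup>2 / (2 * \<sigma>)))
        - indicator {-T..T} x * (\<Sum>k=1..N. \<gamma> k * exp (lam k * of_real x))" for x
  have intF: "integrable lborel (\<lambda>x. (cmod (F x))\<^sup>2)"
    unfolding F_def by (rule square_integrable_gauss_diff[OF \<sigma>])
  let ?tail = "\<lambda>v. exp (- (6 * (v + - \<tau>)\<^sup>2)) + exp (- (6 * (v + \<tau>)\<^sup>2))"
  have tail: "has_bochner_integral lborel ?tail (sqrt (pi / 6) + sqrt (pi / 6))"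
    by (intro has_bochner_integral_add has_bochner_integral_gauss_translate)
  \<comment> \<open>For |v| \<le> \<tau> the weight times 4^N is at least 1; beyond, only the
    Gaussian is left, and its tail bound carries the factor 4^-N.\<close>
  have pointwise: "(cmod (F (0 + s * v)))\<^sup>2 \<le> 4 ^ N * (exp (- (6 * v\<^sup>2)) * (cmod (?g \<gamma> v))\<^sup>2) + (1 / 4 ^ N) * ?tail v" for v
  proof -
    have main: "- (s * v)\<^sup>2 / (2 * \<sigma>) = - 3 * v\<^sup>2"
      using \<sigma> by (simp add: power_mult_distrib s)
    have iff: "s * v \<in> {- T..T} \<longleftrightarrow> \<bar>v\<bar> \<le> \<tau>"
      using s(1) by (simp add: \<tau>_def abs_le_iff field_simps) (auto simp: field_simps)
    show ?thesis
    proof (cases "\<bar>v\<bar> \<le> \<tau>")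
      case True
      then have F: "F (0 + s * v) = ?g \<gamma> v"
        unfolding F_def using iff lam_s[of _ v] main by simp
      have "1 \<le> 4 ^ N * exp (- (6 * v\<^sup>2))"
      proof -
        have "v\<^sup>2 \<le> \<tau>\<^sup>2" using True \<tau> by (metis abs_le_square_iff abs_of_nonneg)
        then have "1 \<le> exp (6 * \<tau>\<^sup>2) * exp (- (6 * v\<^sup>2))"
          by (simp flip: exp_add)
        then show ?thesis by (simp only: exp\<tau>)
      qed
      then have "1 * (cmod (?g \<gamma> v))\<^sup>2 \<le> 4 ^ N * exp (- (6 * v\<^sup>2)) * (cmod (?g \<gamma> v))\<^sup>2"
        by (rule mult_right_mono) simp
      then have "(cmod (F (0 + s * v)))\<^sup>2 \<le> 4 ^ N * (exp (- (6 * v\<^sup>2)) * (cmod (?g \<gamma> v))\<^sup>2)"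
        unfolding F by (simp only: mult_1 mult.assoc)
      moreover have "0 \<le> (1 / 4 ^ N) * ?tail v" by simp
      ultimately show ?thesis by (rule add_increasing2[rotated])
    next
      case False
      then have "F (0 + s * v) = of_real (exp (- 3 * v\<^sup>2))"
        unfolding F_def using iff main by simp
      then have "(cmod (F (0 + s * v)))\<^sup>2 = exp (- (6 * v\<^sup>2))"
        by (simp add: power2_eq_square flip: exp_add)
      also have "\<dots> \<le> exp (- (6 * \<tau>\<^sup>2)) * ?tail v"
        using gauss_tail_le[OF \<tau>, of v] False by simp
      also have "exp (- (6 * \<tau>\<^sup>2)) = 1 / 4 ^ N"
        by (simp only: exp_minus exp\<tau> inverse_eq_divide)
      finally show ?thesis
        by (rule order_trans) simp
    qed
  qed
  have "(LINT v|lborel. (cmod (F (0 + s * v)))\<^sup>2)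
     \<le> (LINT v|lborel. 4 ^ N * (exp (- (6 * v\<^sup>2)) * (cmod (?g \<gamma> v))\<^sup>2) + (1 / 4 ^ N) * ?tail v)"
  proof (rule integral_mono[OF _ _ pointwise])
    show "integrable lborel (\<lambda>v. (cmod (F (0 + s * v)))\<^sup>2)"
      using s(1) by (intro lborel_integrable_real_affine[OF intF]) simp
    show "integrable lborel (\<lambda>v. 4 ^ N * (exp (- (6 * v\<^sup>2)) * (cmod (?g \<gamma> v))\<^sup>2) + (1 / 4 ^ N) * ?tail v)"
      by (intro Bochner_Integration.integrable_add integrable_mult_right intJ integrable.intros[OF tail])
  qed
  also have "\<dots> = 4 ^ N * ?J + (1 / 4 ^ N) * (sqrt (pi / 6) + sqrt (pi / 6))"
    by (intro has_bochner_integral_integral_eq has_bochner_integral_add has_bochner_integral_mult_right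
        tail has_bochner_integral_integrable intJ)
  also have "\<dots> \<le> 4 ^ N * (3 * sqrt (pi / 2) / 2 * real N / 16 ^ N) + (1 / 4 ^ N) * (sqrt (pi / 6) + sqrt (pi / 6))"
    by (intro add_mono mult_left_mono J) auto
  also have "\<dots> = (3 * sqrt (pi / 2) / 2 * real N + 2 * sqrt (pi / 6)) / 4 ^ N"
  proof -
    have "(16 :: real) ^ N = 4 ^ N * 4 ^ N" by (simp flip: power_mult_distrib)
    then show ?thesis by (simp add: add_divide_distrib)
  qed
  \<comment> \<open>The estimate so far is of order N 4^-N; the exponent 3/2 enters through N \<le>
    N^(3/2).\<close>
  also have "\<dots> \<le> (3 * sqrt (pi / 2) / 2 + 2 * sqrt (pi / 6)) * real N powr (3 / 2) / 4 ^ N"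
  proof (rule divide_right_mono)
    have "1 \<le> real N" using N by simp
    then have "real N \<le> real N powr (3 / 2)" "1 \<le> real N powr (3 / 2)"
      using powr_mono[of 1 "3 / 2" "real N"] ge_one_powr_ge_zero[of "real N" "3 / 2"] by simp_all
    then have "3 * sqrt (pi / 2) / 2 * real N + 2 * sqrt (pi / 6) * 1 \<le>
        3 * sqrt (pi / 2) / 2 * real N powr (3 / 2) + 2 * sqrt (pi / 6) * real N powr (3 / 2)"
      using N by (intro add_mono mult_left_mono) auto
    then show "3 * sqrt (pi / 2) / 2 * real N + 2 * sqrt (pi / 6) \<le>
        (3 * sqrt (pi / 2) / 2 + 2 * sqrt (pi / 6)) * real N powr (3 / 2)"
      by (simp add: distrib_right)
  qed simp
  finally have le: "(LINT v|lborel. (cmod (F (0 + s * v)))\<^sup>2)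
      \<le> (3 * sqrt (pi / 2) / 2 + 2 * sqrt (pi / 6)) * real N powr (3 / 2) / 4 ^ N" .
  have pw: "1 / 4 ^ N = (2 :: real) powr (- 2 * real N)"
  proof -
    have "(2 :: real) powr (- 2 * real N) = inverse (2 powr real (2 * N))"
      by (simp add: powr_minus)
    then show ?thesis by (simp add: powr_realpow power_mult inverse_eq_divide del: of_nat_mult)
  qed
  have "(l2_norm F)\<^sup>2 = (LINT x|lborel. (cmod (F x))\<^sup>2)"
    unfolding l2_norm_def by (simp add: Bochner_Integration.integral_nonneg)
  also have "\<dots> = s * (LINT v|lborel. (cmod (F (0 + s * v)))\<^sup>2)"
    using lborel_integral_real_affine[of s "\<lambda>x. (cmod (F x))\<^sup>2" 0] s(1) by simp
  also have "\<dots> \<le> s * ((3 * sqrt (pi / 2) / 2 + 2 * sqrt (pi / 6)) * real N powr (3 / 2) / 4 ^ N)"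
    using s(1) by (intro mult_left_mono le) simp
  also have "\<dots> = s * (3 * sqrt (pi / 2) / 2 + 2 * sqrt (pi / 6)) * (1 / 4 ^ N) * real N powr (3 / 2)"
    by simp
  finally show "(l2_norm (\<lambda>x. of_real (exp (- x\<^sup>2 / (2 * \<sigma>)))
        - indicator {-T..T} x * (\<Sum>k=1..N. \<gamma> k * exp (lam k * of_real x))))\<^sup>2
      \<le> sqrt (6 * \<sigma>) * (3 * sqrt (pi / 2) / 2 + 2 * sqrt (pi / 6)) * 2 powr (- 2 * real N) * real N powr (3 / 2)"
    unfolding F_def[abs_def] s_def pw .
qed

end
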